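(* There is a function $\varepsilon(r)\to0$ (as $r\to\infty$) such that for all integers $r\ge2$, $k\ge1$, $s$ with $1\le s\le(1-\varepsilon(r))\log\log r$, and $n>16r^2(k-1)+1$, $$f(n,r,s,k)\ge 2^{s-2}\cdot\frac nr.$$
   Context: An $r$-edge colouring of $K_n$ assigns to each edge one of $r$ colours. $f(n,r,s,k)$ denotes the largest integer $m$ such that in every $r$-edge colouring of $K_n$ there exist a set $S$ of at most $s$ colours and a $k$-connected subgraph of $K_n$ on at least $m$ vertices all of whose edges have colours in $S$. Logarithms are base $2$. A graph is $k$-connected if it has more than $k$ vertices and remains connected after deleting any set of fewer than $k$ vertices. *)

theory Defs
  imports Complex_Main
begin

text \<open>A simple graph is a pair of a vertex set and a set of edges, each edge being a
  two-element set of vertices.\<close>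

type_synonym 'a graph = "'a set \<times> 'a set set"

abbreviation verts :: "'a graph \<Rightarrow> 'a set" where
  "verts G \<equiv> fst G"

abbreviation edges :: "'a graph \<Rightarrow> 'a set set" where
  "edges G \<equiv> snd G"

definition simple_graph :: "'a graph \<Rightarrow> bool" where
  "simple_graph G \<longleftrightarrow> (\<forall>e\<in>edges G. e \<subseteq> verts G \<and> card e = 2)"

definition subgraph :: "'a graph \<Rightarrow> 'a graph \<Rightarrow> bool" where
  "subgraph H G \<longleftrightarrow> simple_graph H \<and> verts H \<subseteq> verts G \<and> edges H \<subseteq> edges G"

definition complete_graph :: "nat \<Rightarrow> nat graph" where
  "complete_graph n = ({..<n}, {e. e \<subseteq> {..<n} \<and> card e = 2})"

definition delete_verts :: "'a graph \<Rightarrow> 'a set \<Rightarrow> 'a graph" where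
  "delete_verts G X = (verts G - X, {e \<in> edges G. e \<inter> X = {}})"

definition connected_graph :: "'a graph \<Rightarrow> bool" where
  "connected_graph G \<longleftrightarrow> verts G \<noteq> {} \<and>
     (\<forall>u\<in>verts G. \<forall>v\<in>verts G. (u, v) \<in> {(x, y). {x, y} \<in> edges G}\<^sup>*)"

text \<open>All graphs below are finite; \<open>k < card (verts G)\<close> already forces the vertex set
  to be finite.\<close>

definition k_connected :: "nat \<Rightarrow> 'a graph \<Rightarrow> bool" where
  "k_connected k G \<longleftrightarrow> k < card (verts G) \<and>
     (\<forall>X \<subseteq> verts G. card X < k \<longrightarrow> connected_graph (delete_verts G X))"

definition edge_colouring :: "nat \<Rightarrow> 'a graph \<Rightarrow> ('a set \<Rightarrow> nat) \<Rightarrow> bool" where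
  "edge_colouring r G c \<longleftrightarrow> (\<forall>e\<in>edges G. c e < r)"

text \<open>The maximum exists only if every \<open>r\<close>-edge colouring admits some \<open>k\<close>-connected
  subgraph using at most \<open>s\<close> colours, and there is at least one such colouring. Otherwise
  the value is unspecified.\<close>

definition f :: "nat \<Rightarrow> nat \<Rightarrow> nat \<Rightarrow> nat \<Rightarrow> nat" where
  "f n r s k = (GREATEST m. \<forall>c. edge_colouring r (complete_graph n) c \<longrightarrow>
     (\<exists>S H. S \<subseteq> {..<r} \<and> card S \<le> s \<and> subgraph H (complete_graph n) \<and> k_connected k H \<and>
        m \<le> card (verts H) \<and> (\<forall>e\<in>edges H. c e \<in> S)))"

end

theory Submission
  imports Defs "HOL-Real_Asymp.Real_Asymp"
begin

text \<open>
  Put \<open>Q = 2^s\<close> and suppose that no \<open>s\<close> colours contain a \<open>k\<close>-connected subgraph on at least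
  \<open>L = Q n / (4 r)\<close> vertices. Repeatedly cutting along separators with fewer than \<open>k\<close> vertices then
  splits the graph of any \<open>s\<close> colours into parts with fewer than \<open>L\<close> vertices at the cost of few
  edges. In particular, almost all edges can be coloured so that every vertex has degree less than
  \<open>L\<close> in every colour. Hence only few pairs of vertices are joined by the same colour to many common
  neighbours. Call a set of vertices spread if it contains no such pair.

  Merge two copies of a tree by an edge between their roots. Every pair of trees is merged by some
  colour, so pigeonholing over the new colour yields, for each \<open>t < s\<close>, colours \<open>i_1, \<dots>, i_t\<close> with
  about \<open>r (n/r)^(2^t)\<close> binomial trees on \<open>2^t\<close> vertices using just these colours, and most of
  them are spread. The error terms are of relative size \<open>Q^(Q + O(1)) log r / r\<close>, which is where
  \<open>s \<le> (1 - o(1)) log log r\<close> is needed. For \<open>t = s - 1\<close> a spread tree sends about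
  \<open>2^(s-1)\<close> different colours to almost every vertex, so for an average colour \<open>i\<close> it has about
  \<open>2^(s-1) n / r = 2 L\<close> neighbours in colour \<open>i\<close>. Most of the edges involved are not cut
  when the graph of the \<open>s\<close> colours \<open>i_1, \<dots>, i_t, i\<close> is split, so some part has more than \<open>L\<close>
  vertices, a contradiction.
\<close>

section \<open>Splitting a graph without large \<open>k\<close>-connected subgraphs\<close>

definition induced :: "('a \<Rightarrow> 'a \<Rightarrow> bool) \<Rightarrow> 'a set \<Rightarrow> 'a graph" where
  "induced adj U = (U, {e. \<exists>u v. e = {u, v} \<and> u \<in> U \<and> v \<in> U \<and> adj u v})"

text \<open>A graph with more than \<open>k\<close> vertices fails to be \<open>k\<close>-connected
  only through a separator \<open>X\<close>. With \<open>X\<close> removed, one component and the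
  union of the others are joined by no edge, so every edge leaving either side ends in
  \<open>X\<close>, and the smaller side has at most half of \<open>U\<close>.\<close>

lemma small_side_of_separator:
  assumes "finite U" and sym: "symp adj"
    and "k < card U" and "\<not> k_connected k (induced adj U)"
  obtains A X where "A \<subseteq> U" "A \<noteq> {}" "2 * card A \<le> card U" "X \<subseteq> U" "card X < k"
    "\<forall>a\<in>A. \<forall>b\<in>U - A. adj a b \<longrightarrow> b \<in> X"
proof -
  from assms obtain X where X: "X \<subseteq> U" "card X < k"
    and disc: "\<not> connected_graph (delete_verts (induced adj U) X)"
    by (auto simp: k_connected_def induced_def)
  have "U - X \<noteq> {}"
    using X \<open>k < card U\<close> \<open>finite U\<close> by (metis Diff_eq_empty_iff card_mono finite_subset leD le_trans less_imp_le subset_antisym)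
  define E where "E = {(x, y). {x, y} \<in> edges (delete_verts (induced adj U) X)}"
  have E_iff: "(x, y) \<in> E \<longleftrightarrow> x \<in> U - X \<and> y \<in> U - X \<and> adj x y" for x y
    using sympD[OF sym] by (auto simp: E_def delete_verts_def induced_def doubleton_eq_iff)
  obtain u v where uv: "u \<in> U - X" "v \<in> U - X" "(u, v) \<notin> E\<^sup>*"
    using disc \<open>U - X \<noteq> {}\<close>
    by (auto simp: connected_graph_def E_def delete_verts_def induced_def)
  \<comment> \<open>\<open>A\<close> is the component of \<open>u\<close> outside \<open>X\<close>,
    and \<open>B\<close> is the rest, which contains \<open>v\<close>.\<close>
  define A where "A = {w \<in> U - X. (u, w) \<in> E\<^sup>*}"
  define B where "B = U - X - A"
  have sep: "\<not> adj a b" if "a \<in> A" "b \<in> B" for a b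
  proof
    assume "adj a b"
    then have "(a, b) \<in> E" using that by (auto simp: E_iff A_def B_def)
    then have "b \<in> A" using that by (auto simp: A_def B_def intro: rtrancl_into_rtrancl)
    then show False using that by (simp add: B_def)
  qed
  have "u \<in> A" "v \<in> B" using uv by (auto simp: A_def B_def)
  have "card A + card B \<le> card U"
    using \<open>finite U\<close> by (subst card_Un_disjoint[symmetric]) (auto simp: A_def B_def intro!: card_mono)
  then consider "2 * card A \<le> card U" | "2 * card B \<le> card U" by linarith
  then show thesis
  proof cases
    case 1
    show thesis
    proof (rule that[of A X])
      show "\<forall>a\<in>A. \<forall>b\<in>U - A. adj a b \<longrightarrow> b \<in> X" using sep by (auto simp: B_def)
    qed (use 1 X \<open>u \<in> A\<close> in \<open>auto simp: A_def\<close>)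
  next
    case 2
    show thesis
    proof (rule that[of B X])
      show "\<forall>b\<in>B. \<forall>a\<in>U - B. adj b a \<longrightarrow> a \<in> X" using sep sympD[OF sym] by (auto simp: B_def)
    qed (use 2 X \<open>v \<in> B\<close> in \<open>auto simp: B_def\<close>)
  qed
qed

text \<open>Splitting off the smaller side of a separator cuts at most \<open>k - 1\<close> edges per vertex of that
  side, and a vertex lies on the smaller side at most \<open>j\<close> times.\<close>

lemma few_cut_edges:
  fixes L :: real
  assumes "finite U" and sym: "symp adj" and "k < L" and "0 < k"
    and "\<And>U'. U' \<subseteq> U \<Longrightarrow> L \<le> card U' \<Longrightarrow> \<not> k_connected k (induced adj U')"
    and "card U < 2 ^ j * L"
  shows "\<exists>p :: 'a \<Rightarrow> nat. (\<forall>u\<in>U. card {v \<in> U. p v = p u} < L) \<and>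
    card {(u, v). u \<in> U \<and> v \<in> U \<and> adj u v \<and> p u \<noteq> p v} \<le> 2 * (k - 1) * card U * j"
  using assms(1,5,6)
proof (induction "card U" arbitrary: U j rule: less_induct)
  case less
  show ?case
  proof (cases "card U < L")
    case True
    have "{v \<in> U. (0::nat) = 0} = U" by auto
    with True show ?thesis by (intro exI[of _ "\<lambda>_. 0"]) auto
  next
    case False
    then have "k < card U" using \<open>k < L\<close> by linarith
    moreover have "\<not> k_connected k (induced adj U)"
      using less.prems(2)[of U] False by auto
    ultimately obtain A X where A: "A \<subseteq> U" "A \<noteq> {}" "2 * card A \<le> card U"
      and X: "X \<subseteq> U" "card X < k"
      and cut: "\<forall>a\<in>A. \<forall>b\<in>U - A. adj a b \<longrightarrow> b \<in> X"
      by (rule small_side_of_separator[OF less.prems(1) sym])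
    have fin: "finite A" "finite X" using A X less.prems(1) by (auto intro: finite_subset)
    have "card A > 0" using A fin by (simp add: card_gt_0_iff)
    have "0 < k" "L > 0" using \<open>k < L\<close> assms(4) by linarith+
    \<comment> \<open>For \<open>j = 0\<close> the size bound would contradict
      \<open>L \<le> card U\<close>. The small side \<open>A\<close> has at most half the vertices,
      so it continues with \<open>i = j - 1\<close>; the large side keeps \<open>j\<close>.\<close>
    obtain i where j: "j = Suc i"
      using less.prems(3) False by (cases j) auto
    have cardB: "card (U - A) = card U - card A" "card A \<le> card U"
      using A fin \<open>finite U\<close> by (auto simp: card_Diff_subset card_mono)
    have "\<exists>p :: 'a \<Rightarrow> nat. (\<forall>u\<in>A. card {v \<in> A. p v = p u} < L) \<and>
      card {(u, v). u \<in> A \<and> v \<in> A \<and> adj u v \<and> p u \<noteq> p v} \<le> 2 * (k - 1) * card A * i"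
    proof (rule less.hyps)
      show "card A < card U" using A \<open>card A > 0\<close> by linarith
      have "2 * real (card A) \<le> card U" using A(3) by linarith
      then show "card A < 2 ^ i * L" using less.prems(3) by (simp add: j)
    qed (use A fin less.prems in auto)
    then obtain p where p: "\<And>u. u \<in> A \<Longrightarrow> card {v \<in> A. p v = p u} < L"
      "card {(u, v). u \<in> A \<and> v \<in> A \<and> adj u v \<and> p u \<noteq> (p v :: nat)} \<le> 2 * (k - 1) * card A * i"
      by auto
    have "\<exists>p :: 'a \<Rightarrow> nat. (\<forall>u\<in>U - A. card {v \<in> U - A. p v = p u} < L) \<and>
      card {(u, v). u \<in> U - A \<and> v \<in> U - A \<and> adj u v \<and> p u \<noteq> p v} \<le> 2 * (k - 1) * card (U - A) * j"
    proof (rule less.hyps)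
      show "card (U - A) < card U" using cardB \<open>card A > 0\<close> by linarith
      show "card (U - A) < 2 ^ j * L" using less.prems(3) cardB by linarith
    qed (use less.prems in auto)
    then obtain q where q: "\<And>u. u \<in> U - A \<Longrightarrow> card {v \<in> U - A. q v = q u} < L"
      "card {(u, v). u \<in> U - A \<and> v \<in> U - A \<and> adj u v \<and> q u \<noteq> (q v :: nat)}
        \<le> 2 * (k - 1) * card (U - A) * j"
      by auto
    \<comment> \<open>Even labels inside \<open>A\<close> and odd labels outside keep the parts of
      the two sides apart.\<close>
    define l where "l u = (if u \<in> A then 2 * p u else 2 * q u + 1)" for u
    have "card {v \<in> U. l v = l u} < L" if "u \<in> U" for u
    proof (cases "u \<in> A")
      case True
      have "{v \<in> U. l v = l u} = {v \<in> A. p v = p u}"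
        using True A(1) by (auto simp: l_def) presburger+
      then show ?thesis using p(1)[OF True] by simp
    next
      case False
      have "{v \<in> U. l v = l u} = {v \<in> U - A. q v = q u}"
        using False by (auto simp: l_def) presburger+
      then show ?thesis using q(1)[of u] False that by simp
    qed
    moreover have "card {(u, v). u \<in> U \<and> v \<in> U \<and> adj u v \<and> l u \<noteq> l v} \<le> 2 * (k - 1) * card U * j"
    proof -
      let ?P = "{(u, v). u \<in> A \<and> v \<in> A \<and> adj u v \<and> p u \<noteq> p v}"
      let ?Q = "{(u, v). u \<in> U - A \<and> v \<in> U - A \<and> adj u v \<and> q u \<noteq> q v}"
      have finPQ: "finite ?P" "finite ?Q"
        by (rule finite_subset[of _ "U \<times> U"]; use \<open>finite U\<close> A in auto)+
      \<comment> \<open>Ordered pairs are counted, so each edge between \<open>A\<close> and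
        \<open>X\<close> appears in both directions.\<close>
      have "{(u, v). u \<in> U \<and> v \<in> U \<and> adj u v \<and> l u \<noteq> l v} \<subseteq> ?P \<union> ?Q \<union> (A \<times> X \<union> X \<times> A)"
        using cut sympD[OF sym] by (fastforce simp: l_def split: if_splits)
      then have "card {(u, v). u \<in> U \<and> v \<in> U \<and> adj u v \<and> l u \<noteq> l v}
          \<le> card (?P \<union> ?Q \<union> (A \<times> X \<union> X \<times> A))"
        using finPQ fin by (intro card_mono) auto
      also have "\<dots> \<le> card ?P + card ?Q + (card (A \<times> X) + card (X \<times> A))"
        by (meson add_mono card_Un_le order_trans order_refl)
      also have "\<dots> \<le> 2 * (k - 1) * card A * i + 2 * (k - 1) * card (U - A) * j
          + 2 * ((k - 1) * card A)"
      proof -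
        have "card X \<le> k - 1" using X(2) by linarith
        then have "card A * card X \<le> (k - 1) * card A"
          by (subst mult.commute) (rule mult_le_mono1)
        then show ?thesis using p(2) q(2)
          unfolding card_cartesian_product mult.commute[of "card X"] by linarith
      qed
      \<comment> \<open>The new cut costs exactly the one level that \<open>A\<close> has lost:
        \<open>i + 1 = j\<close>.\<close>
      also have "\<dots> = 2 * (k - 1) * (card A + card (U - A)) * j"
        unfolding j by (cases k) (simp_all add: algebra_simps)
      also have "\<dots> = 2 * (k - 1) * card U * j" using cardB by simp
      finally show ?thesis .
    qed
    ultimately show ?thesis by blast
  qed
qed

section \<open>Binomial trees on spread vertex sets\<close>

lemma card_Sigma_le:
  fixes b :: real
  assumes "finite A" "\<And>x. x \<in> A \<Longrightarrow> finite (B x)" "\<And>x. x \<in> A \<Longrightarrow> card (B x) \<le> b"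
  shows "card (Sigma A B) \<le> card A * b"
proof -
  have "real (card (Sigma A B)) = (\<Sum>x\<in>A. real (card (B x)))"
    using assms by (simp add: card_SigmaI)
  also have "\<dots> \<le> card A * b" using assms by (intro sum_bounded_above) auto
  finally show ?thesis .
qed

lemma card_Sigma_ge:
  fixes b :: real
  assumes "finite A" "\<And>x. x \<in> A \<Longrightarrow> finite (B x)" "\<And>x. x \<in> A \<Longrightarrow> b \<le> card (B x)"
  shows "card A * b \<le> card (Sigma A B)"
proof -
  have "card A * b \<le> (\<Sum>x\<in>A. real (card (B x)))" using assms by (intro sum_bounded_below) auto
  also have "\<dots> = card (Sigma A B)" using assms by (simp add: card_SigmaI)
  finally show ?thesis .
qed

lemma card_UN_bounded:
  fixes b :: real
  assumes "finite A" "\<And>x. x \<in> A \<Longrightarrow> card (B x) \<le> b"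
  shows "card (\<Union>x\<in>A. B x) \<le> card A * b"
proof -
  have "real (card (\<Union>x\<in>A. B x)) \<le> real (\<Sum>x\<in>A. card (B x))"
    using card_UN_le[OF assms(1)] of_nat_mono by blast
  also have "\<dots> \<le> card A * b" using assms by (simp add: sum_bounded_above)
  finally show ?thesis .
qed

text \<open>A Bonferroni bound: when the sets are added one by one, each new set loses at most
  \<open>b\<close> to every earlier one. The number of pairs is bounded crudely by the square of
  \<open>card I\<close>.\<close>

lemma card_UN_ge:
  fixes a b :: real
  assumes "finite I" "\<And>i. i \<in> I \<Longrightarrow> finite (A i)" "\<And>i. i \<in> I \<Longrightarrow> a \<le> card (A i)"
    and "\<And>i j. i \<in> I \<Longrightarrow> j \<in> I \<Longrightarrow> i \<noteq> j \<Longrightarrow> card (A i \<inter> A j) \<le> b" and "0 \<le> b"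
  shows "card I * a - (card I)\<^sup>2 * b \<le> card (\<Union>i\<in>I. A i)"
  using assms(1-4)
proof (induction I rule: finite_induct)
  case (insert x F)
  let ?U = "\<Union>i\<in>F. A i"
  have "finite ?U" using insert by auto
  have "A x \<inter> ?U = (\<Union>i\<in>F. A x \<inter> A i)" by auto
  then have "card (A x \<inter> ?U) \<le> card F * b"
    using insert card_UN_bounded[of F "\<lambda>i. A x \<inter> A i" b] by auto
  moreover have "real (card (A x \<union> ?U)) + card (A x \<inter> ?U) = card (A x) + card ?U"
    using insert(4) \<open>finite ?U\<close> card_Un_Int[of "A x" ?U] by (metis insertI1 of_nat_add)
  moreover have "a \<le> card (A x)" using insert by auto
  moreover have "card F * a - (card F)\<^sup>2 * b \<le> card ?U" using insert by auto
  moreover have "(card (insert x F))\<^sup>2 * b \<ge> (card F)\<^sup>2 * b + card F * b"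
    using insert(1,2) \<open>0 \<le> b\<close> by (simp add: power2_eq_square algebra_simps)
  ultimately show ?case using insert(1,2) by (simp add: algebra_simps)
qed simp

text \<open>A value \<open>col x y\<close> of \<open>r\<close> or more means that the pair has no
  usable colour; by \<open>col_valid\<close> such pairs in \<open>W\<close> are near. The relation
  \<open>near\<close> holds every pair that must not occur in a tree.\<close>

locale spread_trees =
  fixes W :: "'a set" and col :: "'a \<Rightarrow> 'a \<Rightarrow> nat" and near :: "'a \<Rightarrow> 'a \<Rightarrow> bool"
    and r :: nat and \<Delta> :: real
  assumes finite_W: "finite W"
    and col_sym: "col x y = col y x"
    and near_sym: "near x y \<Longrightarrow> near y x"
    and col_valid: "x \<in> W \<Longrightarrow> y \<in> W \<Longrightarrow> \<not> near x y \<Longrightarrow> col x y < r"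
    and degree: "x \<in> W \<Longrightarrow> i < r \<Longrightarrow> card {y \<in> W. col x y = i} \<le> \<Delta>"
    and \<Delta>_nonneg: "0 \<le> \<Delta>"
begin

text \<open>An element of \<open>trees is\<close> lists the vertices of a binomial tree, root first, whose edges have
  colours in \<open>is\<close>; two such trees are merged by an edge of the new colour between their roots.\<close>

primrec trees :: "nat list \<Rightarrow> 'a list set" where
  "trees [] = (\<lambda>v. [v]) ` W"
| "trees (i # is) = {ys @ zs | ys zs. ys \<in> trees is \<and> zs \<in> trees is \<and> col (hd ys) (hd zs) = i \<and>
     (\<forall>y\<in>set ys. \<forall>z\<in>set zs. \<not> near y z)}"

lemma length_trees: "ys \<in> trees is \<Longrightarrow> length ys = 2 ^ length is"
  by (induction "is" arbitrary: ys) auto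

lemma trees_subset: "ys \<in> trees is \<Longrightarrow> y \<in> set ys \<Longrightarrow> y \<in> W"
  by (induction "is" arbitrary: ys) auto

lemma trees_not_Nil: "ys \<in> trees is \<Longrightarrow> ys \<noteq> []"
  using length_trees by fastforce

lemma hd_trees: "ys \<in> trees is \<Longrightarrow> hd ys \<in> W"
  using trees_subset trees_not_Nil hd_in_set by blast

lemma hd_eq_nth: "ys \<in> trees is \<Longrightarrow> hd ys = ys ! 0"
  using trees_not_Nil by (rule hd_conv_nth)

lemma finite_trees: "finite (trees is)"
proof (rule finite_subset)
  show "trees is \<subseteq> {ys. set ys \<subseteq> W \<and> length ys = 2 ^ length is}"
    using length_trees trees_subset by auto
qed (rule finite_lists_length_eq[OF finite_W])

text \<open>Stated for positions rather than members, because a list might repeat a vertex. Once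
  \<open>near\<close> is known to be reflexive, distinctness of the list follows from this.\<close>

lemma trees_spread:
  "ys \<in> trees is \<Longrightarrow> a < b \<Longrightarrow> b < length ys \<Longrightarrow> \<not> near (ys ! a) (ys ! b)"
proof (induction "is" arbitrary: ys a b)
  case (Cons i "is")
  then obtain us vs where uv: "ys = us @ vs" "us \<in> trees is" "vs \<in> trees is"
    "\<forall>y\<in>set us. \<forall>z\<in>set vs. \<not> near y z" by auto
  show ?case
  proof (cases "b < length us")
    case True
    then show ?thesis using Cons uv by (auto simp: nth_append)
  next
    case False
    note b = this
    show ?thesis
    proof (cases "a < length us")
      case True
      then show ?thesis using b Cons.prems uv by (auto simp: nth_append)
    next
      case False
      then have "\<not> near (vs ! (a - length us)) (vs ! (b - length us))"
        using b Cons.prems uv by (intro Cons.IH) auto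
      then show ?thesis using False b by (simp add: uv nth_append)
    qed
  qed
qed auto

text \<open>There are at most \<open>\<Delta>\<close> choices for the root. The bound on trees with
  a given root is a hypothesis so that the lemma can serve inside the induction for
  \<open>card_rooted_le\<close>.\<close>

lemma card_attached_le:
  assumes "\<And>v. card {ys \<in> trees is. ys ! 0 = v} \<le> \<Delta> ^ (2 ^ length is - 1)"
    and "w \<in> W" "i < r"
  shows "card {ys \<in> trees is. col w (hd ys) = i} \<le> \<Delta> ^ 2 ^ length is"
proof -
  let ?N = "{v \<in> W. col w v = i}"
  have "{ys \<in> trees is. col w (hd ys) = i} = (\<Union>v\<in>?N. {ys \<in> trees is. ys ! 0 = v})"
    using hd_trees hd_eq_nth by auto
  then have "card {ys \<in> trees is. col w (hd ys) = i} \<le> card ?N * \<Delta> ^ (2 ^ length is - 1)"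
    using card_UN_bounded[of ?N "\<lambda>v. {ys \<in> trees is. ys ! 0 = v}"] assms(1) finite_W by simp
  also have "\<dots> \<le> \<Delta> * \<Delta> ^ (2 ^ length is - 1)"
    using degree[OF assms(2,3)] \<Delta>_nonneg by (intro mult_right_mono) auto
  also have "\<dots> = \<Delta> ^ 2 ^ length is"
    by (subst power_Suc[symmetric]) simp
  finally show ?thesis .
qed

text \<open>Starting from the fixed vertex, each of the other \<open>2 ^ t - 1\<close> vertices,
  where \<open>t = length is\<close>, is one of at most \<open>\<Delta>\<close> neighbours of a
  vertex already placed. In the induction, the half containing position \<open>a\<close> is bounded
  by the induction hypothesis and the other half is attached at its root. Any position is allowed,
  since near pairs and cut edges may meet a tree anywhere.\<close>

lemma card_rooted_le:
  "set is \<subseteq> {..<r} \<Longrightarrow> a < 2 ^ length is \<Longrightarrow>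
    card {ys \<in> trees is. ys ! a = v} \<le> \<Delta> ^ (2 ^ length is - 1)"
proof (induction "is" arbitrary: a v)
  case Nil
  have "{ys \<in> trees []. ys ! a = v} \<subseteq> {[v]}" using Nil by auto
  then have "card {ys \<in> trees []. ys ! a = v} \<le> card {[v]}" by (intro card_mono) auto
  then show ?case by simp
next
  case (Cons i "is")
  let ?t = "2 ^ length is :: nat"
  let ?N = "\<lambda>w. {zs \<in> trees is. col w (hd zs) = i}"
  have N: "card (?N w) \<le> \<Delta> ^ ?t" if "w \<in> W" for w
    using Cons that by (intro card_attached_le Cons.IH) auto
  have fin: "finite {ys \<in> trees is. P ys}" for P using finite_trees by simp
  have pow: "\<Delta> ^ (?t - 1) * \<Delta> ^ ?t = \<Delta> ^ (2 ^ length (i # is) - 1)"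
    by (simp add: power_add[symmetric] mult_2)
  have key: "card (SIGMA ys:{ys \<in> trees is. ys ! b = v}. ?N (hd ys)) \<le> \<Delta> ^ (2 ^ length (i # is) - 1)"
    if "b < ?t" for b
  proof -
    have "card (SIGMA ys:{ys \<in> trees is. ys ! b = v}. ?N (hd ys))
        \<le> card {ys \<in> trees is. ys ! b = v} * \<Delta> ^ ?t"
      using N hd_trees fin by (intro card_Sigma_le) auto
    also have "\<dots> \<le> \<Delta> ^ (?t - 1) * \<Delta> ^ ?t"
      using Cons that \<Delta>_nonneg by (intro mult_right_mono Cons.IH) auto
    finally show ?thesis using pow by simp
  qed
  have finS: "finite (SIGMA ys:{ys \<in> trees is. ys ! b = v}. ?N (hd ys))" for b
    using fin by auto
  show ?case
  proof (cases "a < ?t")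
    case True
    have "{xs \<in> trees (i # is). xs ! a = v}
        \<subseteq> (\<lambda>(ys, zs). ys @ zs) ` (SIGMA ys:{ys \<in> trees is. ys ! a = v}. ?N (hd ys))"
      using True length_trees by (fastforce simp: nth_append image_iff)
    from order_trans[OF of_nat_mono[OF surj_card_le[OF finS this]] key[OF True]]
    show ?thesis .
  next
    case False
    have "{xs \<in> trees (i # is). xs ! a = v}
        \<subseteq> (\<lambda>(zs, ys). ys @ zs) ` (SIGMA ys:{ys \<in> trees is. ys ! (a - ?t) = v}. ?N (hd ys))"
      using False length_trees by (fastforce simp: nth_append image_iff col_sym)
    from order_trans[OF of_nat_mono[OF surj_card_le[OF finS this]] key]
    show ?thesis using False Cons.prems by auto
  qed
qed

text \<open>An ordered pair of trees merges under the colour between its roots unless a vertex of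
  one is near a vertex of the other. The exceptional pairs are bounded by choosing the two
  positions, the near pair placed there, and the trees through its two vertices.\<close>

lemma card_trees_Cons_sum:
  assumes "set is \<subseteq> {..<r}"
  shows "(real (card (trees is)))\<^sup>2 - 4 ^ length is * real (card {(y, z). y \<in> W \<and> z \<in> W \<and> near y z}) *
      (\<Delta> ^ (2 ^ length is - 1))\<^sup>2 \<le> (\<Sum>i<r. real (card (trees (i # is))))"
proof -
  let ?T = "trees is" and ?t = "2 ^ length is :: nat" and ?b = "\<Delta> ^ (2 ^ length is - 1)"
  let ?R = "{(y, z). y \<in> W \<and> z \<in> W \<and> near y z}"
  define P where "P i = {(ys, zs). ys \<in> ?T \<and> zs \<in> ?T \<and> col (hd ys) (hd zs) = i \<and>
     (\<forall>y\<in>set ys. \<forall>z\<in>set zs. \<not> near y z)}" for i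
  define B where "B = (\<Union>(a, b)\<in>{..<?t} \<times> {..<?t}. \<Union>(y, z)\<in>?R.
    {ys \<in> ?T. ys ! a = y} \<times> {zs \<in> ?T. zs ! b = z})"
  have finR: "finite ?R" by (rule finite_subset[of _ "W \<times> W"]) (use finite_W in auto)
  have finP: "finite (P i)" for i
    by (rule finite_subset[of _ "?T \<times> ?T"]) (use finite_trees in \<open>auto simp: P_def\<close>)
  have cardP: "card (P i) = card (trees (i # is))" for i
  proof -
    have "xs \<in> (\<lambda>(ys, zs). ys @ zs) ` P i" if "xs \<in> trees (i # is)" for xs
    proof -
      from that obtain ys zs where "xs = ys @ zs" "(ys, zs) \<in> P i" by (auto simp: P_def)
      then show ?thesis by (auto intro: rev_image_eqI)
    qed
    moreover have "xs \<in> trees (i # is)" if "xs \<in> (\<lambda>(ys, zs). ys @ zs) ` P i" for xs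
      using that by (auto simp: P_def)
    ultimately have "trees (i # is) = (\<lambda>(ys, zs). ys @ zs) ` P i" by blast
    \<comment> \<open>Both halves have length \<open>2 ^ length is\<close>, so a concatenation
      determines them.\<close>
    moreover have "inj_on (\<lambda>(ys, zs). ys @ zs) (P i)"
    proof (rule inj_onI, clarify)
      fix ys zs ys' zs' assume "(ys, zs) \<in> P i" "(ys', zs') \<in> P i" "ys @ zs = ys' @ zs'"
      moreover from this have "length ys = length ys'" 
        using length_trees[of _ "is"] by (simp add: P_def)
      ultimately show "ys = ys' \<and> zs = zs'" by simp
    qed
    ultimately show ?thesis by (simp add: card_image)
  qed
  have "?T \<times> ?T \<subseteq> (\<Union>i<r. P i) \<union> B"
  proof clarify
    fix ys zs assume T: "ys \<in> ?T" "zs \<in> ?T" and "(ys, zs) \<notin> B"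
    have "\<not> near y z" if yz: "y \<in> set ys" "z \<in> set zs" for y z
    proof
      assume "near y z"
      obtain a b where "a < ?t" "ys ! a = y" "b < ?t" "zs ! b = z"
        using yz T length_trees by (auto simp: in_set_conv_nth)
      moreover have "(y, z) \<in> ?R" using T yz \<open>near y z\<close> trees_subset by blast
      ultimately have "(ys, zs) \<in> B" unfolding B_def using T
        by (intro UN_I[of "(a, b)"] ) (auto intro!: UN_I[of "(y, z)"])
      then show False using \<open>(ys, zs) \<notin> B\<close> by simp
    qed
    moreover from this have "col (hd ys) (hd zs) < r"
      using T by (intro col_valid hd_trees) (auto simp: trees_not_Nil)
    ultimately show "(ys, zs) \<in> (\<Union>i<r. P i)" using T by (auto simp: P_def)
  qed
  moreover have "finite B" unfolding B_def using finR finite_trees by auto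
  ultimately have "card (?T \<times> ?T) \<le> card ((\<Union>i<r. P i) \<union> B)"
    using finP by (intro card_mono) auto
  also have "\<dots> \<le> (\<Sum>i<r. card (P i)) + card B"
    using card_UN_le[of "{..<r}" P] card_Un_le[of "\<Union>i<r. P i" B] by simp
  finally have "real (card (?T \<times> ?T)) \<le> real ((\<Sum>i<r. card (P i)) + card B)"
    using of_nat_mono by blast
  then have "(real (card ?T))\<^sup>2 \<le> (\<Sum>i<r. real (card (trees (i # is)))) + card B"
    by (simp only: card_cartesian_product cardP of_nat_add of_nat_sum of_nat_mult power2_eq_square)
  moreover have "card B \<le> card ({..<?t} \<times> {..<?t}) * (card ?R * ?b\<^sup>2)"
    unfolding B_def
  proof (rule card_UN_bounded)
    fix ab assume ab: "ab \<in> {..<?t} \<times> {..<?t}"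
    obtain a b where [simp]: "ab = (a, b)" by fastforce
    have "card (\<Union>(y, z)\<in>?R. {ys \<in> ?T. ys ! a = y} \<times> {zs \<in> ?T. zs ! b = z}) \<le> card ?R * ?b\<^sup>2"
    proof (rule card_UN_bounded[OF finR], clarify)
      fix y z
      have "real (card {ys \<in> ?T. ys ! a = y}) * card {zs \<in> ?T. zs ! b = z} \<le> ?b * ?b"
        using ab \<Delta>_nonneg by (intro mult_mono card_rooted_le assms) auto
      then show "card ({ys \<in> ?T. ys ! a = y} \<times> {zs \<in> ?T. zs ! b = z}) \<le> ?b\<^sup>2"
        by (simp add: card_cartesian_product power2_eq_square)
    qed
    then show "card (case ab of (a, b) \<Rightarrow> \<Union>(y, z)\<in>?R. {ys \<in> ?T. ys ! a = y} \<times> {zs \<in> ?T. zs ! b = z})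
        \<le> card ?R * ?b\<^sup>2" by simp
  qed simp
  moreover have "real (card ({..<?t} \<times> {..<?t})) = 4 ^ length is"
    by (simp add: card_cartesian_product power_mult_distrib[symmetric])
  ultimately show ?thesis
    by (simp only: mult.assoc diff_le_eq)
qed

text \<open>If \<open>p\<close> is not constant on a tree, then one of its \<open>2 ^ t - 1\<close>
  edges is cut, where \<open>t = length is\<close>; fixing that edge leaves at most
  \<open>2 ^ t - 2\<close> further vertices to choose. The factor \<open>\<Delta>\<close> on the
  left avoids this exponent, which would be truncated for \<open>t = 0\<close>, and avoids dividing
  by a possibly zero \<open>\<Delta>\<close>.\<close>

lemma card_nonconstant_le:
  fixes p :: "'a \<Rightarrow> nat" and \<rho> :: real
  assumes "card {(u, v). u \<in> W \<and> v \<in> W \<and> col u v \<in> S \<and> p u \<noteq> p v} \<le> \<rho>"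
    and "set is \<subseteq> {..<r}" "set is \<subseteq> S"
  shows "card {ys \<in> trees is. \<exists>y\<in>set ys. p y \<noteq> p (hd ys)} * \<Delta>
    \<le> (2 ^ length is - 1) * \<rho> * \<Delta> ^ (2 ^ length is - 1)"
  using assms(2,3)
proof (induction "is")
  case Nil
  have none: "{ys \<in> trees []. \<exists>y\<in>set ys. p y \<noteq> p (hd ys)} = {}" by auto
  show ?case unfolding none by simp
next
  case (Cons i "is")
  let ?T = "trees is" and ?t = "2 ^ length is :: nat" and ?b = "\<Delta> ^ (2 ^ length is - 1)"
  let ?R = "{(u, v). u \<in> W \<and> v \<in> W \<and> col u v \<in> S \<and> p u \<noteq> p v}"
  define H where "H = {ys \<in> ?T. \<exists>y\<in>set ys. p y \<noteq> p (hd ys)}"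
  define X where "X = (SIGMA ys:H. {zs \<in> ?T. col (hd ys) (hd zs) = i})"
  define Y where "Y = (\<Union>(u, v)\<in>?R. {ys \<in> ?T. ys ! 0 = u} \<times> {zs \<in> ?T. zs ! 0 = v})"
  have finR: "finite ?R" by (rule finite_subset[of _ "W \<times> W"]) (use finite_W in auto)
  have "finite H" using finite_trees by (simp add: H_def)
  have finX: "finite X" using finite_trees \<open>finite H\<close> by (simp add: X_def)
  have finY: "finite Y" unfolding Y_def using finR finite_trees by auto
  have iss: "set is \<subseteq> {..<r}" "set is \<subseteq> S" "i < r" "i \<in> S" using Cons.prems by auto
  have "{xs \<in> trees (i # is). \<exists>y\<in>set xs. p y \<noteq> p (hd xs)}
      \<subseteq> (\<lambda>(ys, zs). ys @ zs) ` X \<union> (\<lambda>(zs, ys). ys @ zs) ` X \<union> (\<lambda>(ys, zs). ys @ zs) ` Y"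
  proof (intro subsetI, elim CollectE conjE)
    fix xs assume "xs \<in> trees (i # is)" and non: "\<exists>y\<in>set xs. p y \<noteq> p (hd xs)"
    then obtain ys zs where yz: "xs = ys @ zs" "ys \<in> ?T" "zs \<in> ?T" "col (hd ys) (hd zs) = i"
      by auto
    \<comment> \<open>The cut edge lies in the first half, in the second half, or joins the two
      roots.\<close>
    consider "ys \<in> H" | "zs \<in> H" | "p (hd ys) \<noteq> p (hd zs)"
      using non yz trees_not_Nil by (cases "p (hd ys) = p (hd zs)") (auto simp: H_def)
    then show "xs \<in> (\<lambda>(ys, zs). ys @ zs) ` X \<union> (\<lambda>(zs, ys). ys @ zs) ` X \<union> (\<lambda>(ys, zs). ys @ zs) ` Y"
    proof cases
      case 1
      then have "(ys, zs) \<in> X" using yz by (simp add: X_def)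
      then show ?thesis using yz by force
    next
      case 2
      then have "(zs, ys) \<in> X" using yz by (simp add: X_def col_sym)
      then show ?thesis using yz by force
    next
      case 3
      then have "(hd ys, hd zs) \<in> ?R" using yz hd_trees iss by auto
      then have "(ys, zs) \<in> Y" unfolding Y_def using yz hd_eq_nth
        by (intro UN_I[of "(hd ys, hd zs)"]) auto
      then show ?thesis using yz by force
    qed
  qed
  then have "card {xs \<in> trees (i # is). \<exists>y\<in>set xs. p y \<noteq> p (hd xs)}
    \<le> card ((\<lambda>(ys, zs). ys @ zs) ` X \<union> (\<lambda>(zs, ys). ys @ zs) ` X \<union> (\<lambda>(ys, zs). ys @ zs) ` Y)"
    using finX finY by (intro card_mono) auto
  also have "\<dots> \<le> card X + card X + card Y"
    by (intro order_trans[OF card_Un_le] add_mono card_image_le finX finY)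
  finally have "real (card {xs \<in> trees (i # is). \<exists>y\<in>set xs. p y \<noteq> p (hd xs)})
    \<le> real (card X + card X + card Y)"
    using of_nat_mono by blast
  moreover have "card X \<le> card H * \<Delta> ^ ?t"
    unfolding X_def using iss finite_trees \<open>finite H\<close>
    by (intro card_Sigma_le card_attached_le card_rooted_le) (auto simp: H_def hd_trees)
  moreover have "card Y \<le> card ?R * (?b * ?b)"
    unfolding Y_def
  proof (rule card_UN_bounded[OF finR], clarify)
    fix u v
    have "real (card {ys \<in> ?T. ys ! 0 = u}) * card {zs \<in> ?T. zs ! 0 = v} \<le> ?b * ?b"
      using iss \<Delta>_nonneg by (intro mult_mono card_rooted_le) auto
    then show "card ({ys \<in> ?T. ys ! 0 = u} \<times> {zs \<in> ?T. zs ! 0 = v}) \<le> ?b * ?b"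
      by (simp add: card_cartesian_product)
  qed
  moreover have "card ?R * (?b * ?b) \<le> \<rho> * (?b * ?b)"
    using assms(1) \<Delta>_nonneg by (intro mult_right_mono) auto
  ultimately have "card {xs \<in> trees (i # is). \<exists>y\<in>set xs. p y \<noteq> p (hd xs)}
      \<le> 2 * (card H * \<Delta> ^ ?t) + \<rho> * (?b * ?b)"
    by linarith
  then have "card {xs \<in> trees (i # is). \<exists>y\<in>set xs. p y \<noteq> p (hd xs)} * \<Delta>
      \<le> (2 * (card H * \<Delta> ^ ?t) + \<rho> * (?b * ?b)) * \<Delta>"
    using \<Delta>_nonneg by (rule mult_right_mono)
  also have "\<dots> = 2 * (card H * \<Delta>) * \<Delta> ^ ?t + \<rho> * (?b * (\<Delta> * ?b))"
    by (simp add: algebra_simps)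
  also have "\<dots> \<le> 2 * ((2 ^ length is - 1) * \<rho> * ?b) * \<Delta> ^ ?t + \<rho> * (?b * (\<Delta> * ?b))"
    using Cons.IH iss \<Delta>_nonneg by (intro add_mono mult_right_mono mult_left_mono) (auto simp: H_def)
  also have "\<Delta> * ?b = \<Delta> ^ ?t" by (subst power_Suc[symmetric]) simp
  \<comment> \<open>Two halves and one new edge:
    \<open>2 * (2 ^ t - 1) + 1 = 2 ^ (t + 1) - 1\<close>.\<close>
  also have "2 * ((2 ^ length is - 1) * \<rho> * ?b) * \<Delta> ^ ?t + \<rho> * (?b * \<Delta> ^ ?t)
      = (2 ^ length (i # is) - 1) * \<rho> * (?b * \<Delta> ^ ?t)"
    by (simp add: algebra_simps)
  also have "?b * \<Delta> ^ ?t = \<Delta> ^ (2 ^ length (i # is) - 1)"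
    by (simp add: power_add[symmetric] mult_2)
  finally show ?case .
qed

text \<open>With \<open>x\<close> as the average degree in a colour, the expected count is
  \<open>r * x ^ 2 ^ t\<close>. Squaring the lower bound doubles the relative error and the near
  pairs add another \<open>\<beta>\<close>, so the error \<open>h\<close> becomes
  \<open>2 * h + \<beta>\<close>, which gives the coefficients \<open>2 ^ (t + 1) - 1\<close>. The
  new colour is chosen by pigeonhole.\<close>

lemma many_trees:
  fixes x Q \<beta> :: real
  assumes "0 < r" "0 < x" "1 \<le> Q" "0 \<le> \<beta>" and \<Delta>: "\<Delta> = Q * x"
    and W: "r * x * (1 - \<beta>) \<le> card W"
    and near: "4 ^ T * real (card {(y, z). y \<in> W \<and> z \<in> W \<and> near y z}) * Q ^ 2 ^ T
      \<le> \<beta> * (real r)\<^sup>2 * x\<^sup>2"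
    and \<beta>: "2 ^ (T + 1) * \<beta> \<le> 1"
  shows "t \<le> T \<Longrightarrow> \<exists>is. length is = t \<and> set is \<subseteq> {..<r} \<and>
    r * x ^ 2 ^ t * (1 - (2 ^ (t + 1) - 1) * \<beta>) \<le> card (trees is)"
proof (induction t)
  case 0
  have "card (trees []) = card W" by (simp add: card_image inj_on_def)
  then show ?case using W by (intro exI[of _ "[]"]) simp
next
  case (Suc t)
  then obtain "is" where iss: "length is = t" "set is \<subseteq> {..<r}"
    and card_is: "r * x ^ 2 ^ t * (1 - (2 ^ (t + 1) - 1) * \<beta>) \<le> card (trees is)" by auto
  let ?N = "real (card {(y, z). y \<in> W \<and> z \<in> W \<and> near y z})"
  define m where "m = (2 ^ t - 1 :: nat)"
  define y where "y = x ^ m"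
  define h where "h = (2 ^ (t + 1) - 1) * \<beta>"
  have pow: "x ^ 2 ^ t = x * y"
    unfolding y_def m_def by (subst power_Suc[symmetric]) simp
  have pow2: "x ^ 2 ^ Suc t = (x * y)\<^sup>2"
    by (simp add: pow[symmetric] power_mult[symmetric] mult.commute)
  have "y > 0" using \<open>0 < x\<close> by (simp add: y_def)
  have "(2::real) ^ (t + 1) \<le> 2 ^ (T + 1)" using Suc.prems by (intro power_increasing) auto
  from order_trans[OF mult_right_mono[OF this \<open>0 \<le> \<beta>\<close>] \<beta>]
  have "2 ^ (t + 1) * \<beta> \<le> 1" .
  \<comment> \<open>The lower bound must be nonnegative before it can be squared.\<close>
  then have h: "0 \<le> 1 - h" using \<open>0 \<le> \<beta>\<close> by (simp add: h_def algebra_simps)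
  have "(r * (x * y) * (1 - h))\<^sup>2 \<le> (real (card (trees is)))\<^sup>2"
    using card_is h \<open>0 < x\<close> \<open>0 < y\<close> by (intro power_mono) (auto simp: pow h_def)
  moreover have "(r * (x * y))\<^sup>2 * (1 - 2 * h) \<le> (r * (x * y) * (1 - h))\<^sup>2"
  proof -
    have "1 - 2 * h \<le> (1 - h)\<^sup>2" by (simp add: power2_eq_square algebra_simps)
    then show ?thesis by (simp add: power_mult_distrib mult_left_mono)
  qed
  \<comment> \<open>Trees through a given vertex are bounded with \<open>\<Delta> = Q * x\<close>
    instead of \<open>x\<close>. The surplus is \<open>Q\<close> to the power
    \<open>2 * (2 ^ t - 1)\<close>, which is at most \<open>Q ^ 2 ^ T\<close>.\<close>
  moreover have "4 ^ length is * ?N * (\<Delta> ^ (2 ^ length is - 1))\<^sup>2 \<le> (r * (x * y))\<^sup>2 * \<beta>"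
  proof -
    have "(2::nat) * 2 ^ t \<le> 2 ^ T"
      using Suc.prems power_increasing[of "Suc t" T "2::nat"] by simp
    then have "m * 2 \<le> 2 ^ T" by (simp add: m_def)
    then have "(Q ^ m)\<^sup>2 \<le> Q ^ 2 ^ T"
      unfolding power_mult[symmetric] using \<open>1 \<le> Q\<close> by (intro power_increasing) auto
    moreover have "(4::real) ^ t \<le> 4 ^ T" using Suc.prems by (intro power_increasing) auto
    ultimately have "4 ^ t * ?N * (Q ^ m)\<^sup>2 \<le> 4 ^ T * ?N * Q ^ 2 ^ T"
      using \<open>1 \<le> Q\<close> by (intro mult_mono) auto
    also note near
    finally have "4 ^ t * ?N * (Q ^ m)\<^sup>2 * y\<^sup>2 \<le> \<beta> * (real r)\<^sup>2 * x\<^sup>2 * y\<^sup>2"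
      by (intro mult_right_mono) auto
    then show ?thesis
      unfolding iss \<Delta> m_def[symmetric] y_def by (simp add: power_mult_distrib mult_ac)
  qed
  ultimately have sum: "(r * (x * y))\<^sup>2 * (1 - 2 * h) - (r * (x * y))\<^sup>2 * \<beta>
      \<le> (\<Sum>i<r. real (card (trees (i # is))))"
    using card_trees_Cons_sum[OF iss(2)] by linarith
  \<comment> \<open>The lower bound for all merged pairs, averaged over the \<open>r\<close>
    colours.\<close>
  define b where "b = r * (x * y)\<^sup>2 * (1 - (2 ^ (t + 2) - 1) * \<beta>)"
  have "r * b = (r * (x * y))\<^sup>2 * (1 - 2 * h) - (r * (x * y))\<^sup>2 * \<beta>"
    by (simp add: b_def h_def power2_eq_square algebra_simps)
  with sum have "(\<Sum>i<r. b) \<le> (\<Sum>i<r. real (card (trees (i # is))))" by simp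
  moreover have "(\<Sum>i<r. real (card (trees (i # is)))) < (\<Sum>i<r. b)"
    if "\<And>i. i < r \<Longrightarrow> card (trees (i # is)) < b"
    using that \<open>0 < r\<close> by (intro sum_strict_mono) auto
  ultimately obtain i where "i < r" "b \<le> card (trees (i # is))" by fastforce
  then show ?case
    using iss by (intro exI[of _ "i # is"]) (simp add: b_def pow2[symmetric] del: trees.simps)
qed

text \<open>Double counting of triples of a tree, a vertex \<open>x\<close> and a colour
  \<open>i\<close> in which \<open>x\<close> meets the tree. If neither the tree nor the joining
  edge is cut by \<open>p i\<close>, then \<open>x\<close> lies in the class of the root, which
  allows \<open>L\<close> vertices per colour (\<open>G\<close>). Otherwise the tree is cut
  (\<open>B1\<close>) or the joining edge is cut (\<open>B2\<close>).\<close>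

lemma card_joined_triples_le:
  fixes p :: "nat \<Rightarrow> 'a \<Rightarrow> nat" and V :: "'a set" and \<rho> L M :: real
  assumes "finite V" "W \<subseteq> V" and iss: "set is \<subseteq> {..<r}" "length is = t"
    and deg: "\<And>y i. y \<in> W \<Longrightarrow> i < r \<Longrightarrow> card {x \<in> V. col x y = i} \<le> \<Delta>"
    and classes: "\<And>u i. u \<in> V \<Longrightarrow> i < r \<Longrightarrow> card {v \<in> V. p i v = p i u} \<le> L"
    and cut: "\<And>i. i < r \<Longrightarrow>
      card {(u, v). u \<in> V \<and> v \<in> V \<and> col u v \<in> insert i (set is) \<and> p i u \<noteq> p i v} \<le> \<rho>"
    and joined: "\<And>ys. ys \<in> trees is \<Longrightarrow>
      M \<le> card {(x, i). x \<in> V \<and> i < r \<and> (\<exists>y\<in>set ys. col x y = i)}"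
  shows "card (trees is) * M \<le>
    card (trees is) * (r * L) + r * (2 ^ t :: real)\<^sup>2 * \<rho> * \<Delta> ^ (2 ^ t - 1)"
proof -
  let ?T = "trees is" and ?D = "2 ^ t :: nat"
  define J where "J ys = {(x, i). x \<in> V \<and> i < r \<and> (\<exists>y\<in>set ys. col x y = i)}" for ys
  define R where "R i = {(u, v). u \<in> V \<and> v \<in> V \<and> col u v \<in> insert i (set is) \<and> p i u \<noteq> p i v}" for i
  define H where "H i = {ys \<in> ?T. \<exists>y\<in>set ys. p i y \<noteq> p i (hd ys)}" for i
  define G where "G = (SIGMA ys:?T. SIGMA i:{..<r}. {x \<in> V. p i x = p i (hd ys)})"
  define B1 where "B1 = (SIGMA i:{..<r}. SIGMA ys:H i. \<Union>y\<in>set ys. {x \<in> V. col x y = i})"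
  define B2 where
    "B2 = (SIGMA i:{..<r}. \<Union>a<?D. SIGMA xv:R i. {ys \<in> ?T. ys ! a = snd xv})"
  have fT: "finite ?T" by (rule finite_trees)
  have fR: "finite (R i)" for i
    by (rule finite_subset[of _ "V \<times> V"]) (use \<open>finite V\<close> in \<open>auto simp: R_def\<close>)
  have fH: "finite (H i)" for i using fT by (simp add: H_def)
  have fJ: "finite (J ys)" for ys
    by (rule finite_subset[of _ "V \<times> {..<r}"]) (use \<open>finite V\<close> in \<open>auto simp: J_def\<close>)
  have fG: "finite G" using fT \<open>finite V\<close> unfolding G_def by auto
  have fB1: "finite B1" using fH \<open>finite V\<close> unfolding B1_def by auto
  have fB2: "finite B2" using fR fT unfolding B2_def by auto
  have len: "length ys = ?D" if "ys \<in> ?T" for ys using length_trees[OF that] iss by simp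
  have card_set: "card (set ys) \<le> ?D" if "ys \<in> ?T" for ys
    using card_length[of ys] len[OF that] by simp

  have "Sigma ?T J \<subseteq> (\<lambda>(ys, i, x). (ys, x, i)) ` G \<union> (\<lambda>(i, ys, x). (ys, x, i)) ` B1
      \<union> (\<lambda>(i, xv, ys). (ys, fst xv, i)) ` B2"
  proof clarify
    fix ys x i
    assume ys: "ys \<in> ?T" and "(x, i) \<in> J ys"
      and no2: "(ys, x, i) \<notin> (\<lambda>(i, xv, ys). (ys, fst xv, i)) ` B2"
      and no1: "(ys, x, i) \<notin> (\<lambda>(i, ys, x). (ys, x, i)) ` B1"
    then obtain y where y: "x \<in> V" "i < r" "y \<in> set ys" "col x y = i" by (auto simp: J_def)
    have "y \<in> V" using y ys trees_subset \<open>W \<subseteq> V\<close> by blast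
    have "ys \<notin> H i"
    proof
      assume "ys \<in> H i"
      then have "(i, ys, x) \<in> B1" using y by (auto simp: B1_def)
      then show False using no1 by force
    qed
    then have "p i y = p i (hd ys)" using ys y by (auto simp: H_def)
    moreover have "p i x = p i y"
    proof (rule ccontr)
      assume "p i x \<noteq> p i y"
      then have "(x, y) \<in> R i" using y \<open>y \<in> V\<close> by (auto simp: R_def)
      moreover obtain a where "a < ?D" "ys ! a = y"
        using y len[OF ys] by (auto simp: in_set_conv_nth)
      ultimately have "(i, (x, y), ys) \<in> B2" using y ys by (auto simp: B2_def)
      then show False using no2 by force
    qed
    ultimately have "(ys, i, x) \<in> G" using ys y by (auto simp: G_def)
    then show "(ys, x, i) \<in> (\<lambda>(ys, i, x). (ys, x, i)) ` G" by force
  qed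
  then have "card (Sigma ?T J) \<le> card ((\<lambda>(ys, i, x). (ys, x, i)) ` G \<union> (\<lambda>(i, ys, x). (ys, x, i)) ` B1
      \<union> (\<lambda>(i, xv, ys). (ys, fst xv, i)) ` B2)"
    using fG fB1 fB2 by (intro card_mono) auto
  also have "\<dots> \<le> card G + card B1 + card B2"
    by (intro order_trans[OF card_Un_le] add_mono card_image_le fG fB1 fB2)
  finally have "real (card (Sigma ?T J)) \<le> card G + card B1 + card B2"
    using of_nat_mono by fastforce
  moreover have "card ?T * M \<le> card (Sigma ?T J)"
    using fT fJ joined by (intro card_Sigma_ge) (auto simp: J_def)
  moreover have "card G \<le> card ?T * (r * L)"
  proof -
    have "card (SIGMA i:{..<r}. {x \<in> V. p i x = p i (hd ys)}) \<le> card {..<r} * L" if "ys \<in> ?T" for ys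
      using \<open>finite V\<close> \<open>W \<subseteq> V\<close> hd_trees[OF that] by (intro card_Sigma_le classes) auto
    then show ?thesis unfolding G_def using fT \<open>finite V\<close> by (intro card_Sigma_le) auto
  qed
  moreover have "card B1 \<le> r * (real (?D - 1) * ?D * \<rho> * \<Delta> ^ (?D - 1))"
  proof -
    have "card (SIGMA ys:H i. \<Union>y\<in>set ys. {x \<in> V. col x y = i})
        \<le> real (?D - 1) * ?D * \<rho> * \<Delta> ^ (?D - 1)" if "i < r" for i
    proof -
      have "card (\<Union>y\<in>set ys. {x \<in> V. col x y = i}) \<le> ?D * \<Delta>" if "ys \<in> ?T" for ys
      proof -
        have "card (\<Union>y\<in>set ys. {x \<in> V. col x y = i}) \<le> card (set ys) * \<Delta>"
          using that trees_subset \<open>i < r\<close> by (intro card_UN_bounded deg) auto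
        also have "\<dots> \<le> ?D * \<Delta>"
          using card_set[OF that] \<Delta>_nonneg by (intro mult_right_mono) (auto simp flip: of_nat_le_iff)
        finally show ?thesis .
      qed
      then have "card (SIGMA ys:H i. \<Union>y\<in>set ys. {x \<in> V. col x y = i}) \<le> card (H i) * (?D * \<Delta>)"
        using fH \<open>finite V\<close> by (intro card_Sigma_le) (auto simp: H_def)
      also have "\<dots> = ?D * (card (H i) * \<Delta>)" by simp
      also have "\<dots> \<le> ?D * ((2 ^ length is - 1) * \<rho> * \<Delta> ^ (2 ^ length is - 1))"
      proof (rule mult_left_mono)
        have "{(u, v). u \<in> W \<and> v \<in> W \<and> col u v \<in> insert i (set is) \<and> p i u \<noteq> p i v} \<subseteq> R i"
          using \<open>W \<subseteq> V\<close> by (auto simp: R_def)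
        then have "card {(u, v). u \<in> W \<and> v \<in> W \<and> col u v \<in> insert i (set is) \<and> p i u \<noteq> p i v} \<le> \<rho>"
          using card_mono[OF fR] cut[OF that] unfolding R_def by (meson of_nat_mono order_trans)
        then show "card (H i) * \<Delta> \<le> (2 ^ length is - 1) * \<rho> * \<Delta> ^ (2 ^ length is - 1)"
          unfolding H_def by (rule card_nonconstant_le) (use iss in auto)
      qed simp
      finally show ?thesis by (simp add: iss mult_ac of_nat_diff)
    qed
    then have "card B1 \<le> card {..<r} * (real (?D - 1) * ?D * \<rho> * \<Delta> ^ (?D - 1))"
      unfolding B1_def using fH \<open>finite V\<close> by (intro card_Sigma_le) auto
    then show ?thesis by simp
  qed
  moreover have "card B2 \<le> r * (?D * (\<rho> * \<Delta> ^ (?D - 1)))"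
  proof -
    have "card (\<Union>a<?D. SIGMA xv:R i. {ys \<in> ?T. ys ! a = snd xv}) \<le> ?D * (\<rho> * \<Delta> ^ (?D - 1))"
      if "i < r" for i
    proof -
      have "card (SIGMA xv:R i. {ys \<in> ?T. ys ! a = snd xv}) \<le> \<rho> * \<Delta> ^ (?D - 1)" if "a < ?D" for a
      proof -
        have "card (SIGMA xv:R i. {ys \<in> ?T. ys ! a = snd xv}) \<le> card (R i) * \<Delta> ^ (?D - 1)"
          using fR fT card_rooted_le[OF iss(1)] that iss(2) by (intro card_Sigma_le) auto
        also have "\<dots> \<le> \<rho> * \<Delta> ^ (?D - 1)"
          using cut[OF \<open>i < r\<close>] \<Delta>_nonneg by (intro mult_right_mono) (auto simp: R_def)
        finally show ?thesis .
      qed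
      then have "card (\<Union>a<?D. SIGMA xv:R i. {ys \<in> ?T. ys ! a = snd xv})
          \<le> card {..<?D} * (\<rho> * \<Delta> ^ (?D - 1))"
        by (intro card_UN_bounded) auto
      then show ?thesis by simp
    qed
    then have "card B2 \<le> card {..<r} * (?D * (\<rho> * \<Delta> ^ (?D - 1)))"
      unfolding B2_def using fR fT by (intro card_Sigma_le) auto
    then show ?thesis by simp
  qed
  \<comment> \<open>The two error terms combine through
    \<open>(D - 1) * D + D = D^2\<close>.\<close>
  moreover have "r * (real (?D - 1) * ?D * \<rho> * \<Delta> ^ (?D - 1)) + r * (?D * (\<rho> * \<Delta> ^ (?D - 1)))
      = r * (2 ^ t :: real)\<^sup>2 * \<rho> * \<Delta> ^ (?D - 1)"
    by (simp add: of_nat_diff power2_eq_square algebra_simps)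
  ultimately show ?thesis by linarith
qed

text \<open>Each tree vertex \<open>y\<close> contributes the pairs \<open>(x, col x y)\<close>, at
  least \<open>a\<close> of them. Two such sets meet exactly where \<open>y\<close> and
  \<open>z\<close> agree, hence in at most \<open>b\<close> pairs, and \<open>card_UN_ge\<close>
  applies.\<close>

lemma card_joined_ge:
  fixes a b :: real
  assumes "finite V" "0 \<le> b" "ys \<in> trees is" "length is = t"
    and "\<And>y. near y y"
    and valid: "\<And>y. y \<in> W \<Longrightarrow> a \<le> card {x \<in> V. col x y < r}"
    and agree: "\<And>y z. y \<in> W \<Longrightarrow> z \<in> W \<Longrightarrow> \<not> near y z \<Longrightarrow>
      card {x \<in> V. col x y = col x z \<and> col x y < r} \<le> b"
  shows "2 ^ t * a - (2 ^ t)\<^sup>2 * b \<le> card {(x, i). x \<in> V \<and> i < r \<and> (\<exists>y\<in>set ys. col x y = i)}"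
proof -
  define A where "A y = {(x, col x y) | x. x \<in> V \<and> col x y < r}" for y
  have W: "y \<in> W" if "y \<in> set ys" for y using assms(3) trees_subset that by blast
  have cardA: "card (A y) = card {x \<in> V. col x y < r}" for y
  proof -
    have "A y = (\<lambda>x. (x, col x y)) ` {x \<in> V. col x y < r}" by (auto simp: A_def)
    then show ?thesis by (simp add: card_image inj_on_def)
  qed
  have cardAA: "card (A y \<inter> A z) = card {x \<in> V. col x y = col x z \<and> col x y < r}" for y z
  proof -
    have "A y \<inter> A z = (\<lambda>x. (x, col x y)) ` {x \<in> V. col x y = col x z \<and> col x y < r}"
      by (auto simp: A_def)
    then show ?thesis by (simp add: card_image inj_on_def)
  qed
  have finA: "finite (A y)" for y
    by (rule finite_subset[of _ "V \<times> {..<r}"]) (use \<open>finite V\<close> in \<open>auto simp: A_def\<close>)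
  have far: "\<not> near (ys ! i) (ys ! j)" if "i \<noteq> j" "i < length ys" "j < length ys" for i j
    using trees_spread[OF assms(3)] near_sym that by (metis linorder_neqE_nat)
  then have "distinct ys" using \<open>\<And>y. near y y\<close> by (metis distinct_conv_nth)
  then have "card (set ys) = 2 ^ t"
    using length_trees[OF assms(3)] \<open>length is = t\<close> by (simp add: distinct_card)
  moreover have "card (set ys) * a - (card (set ys))\<^sup>2 * b \<le> card (\<Union>y\<in>set ys. A y)"
  proof (rule card_UN_ge[OF _ finA _ _ \<open>0 \<le> b\<close>])
    show "a \<le> card (A y)" if "y \<in> set ys" for y using valid W[OF that] by (simp add: cardA)
    show "card (A y \<inter> A z) \<le> b" if "y \<in> set ys" "z \<in> set ys" "y \<noteq> z" for y z
    proof -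
      obtain i j where "i < length ys" "ys ! i = y" "j < length ys" "ys ! j = z"
        using \<open>y \<in> set ys\<close> \<open>z \<in> set ys\<close> by (metis in_set_conv_nth)
      then have "\<not> near y z" using far[of i j] \<open>y \<noteq> z\<close> by auto
      then show ?thesis unfolding cardAA using that W by (intro agree) auto
    qed
  qed simp
  moreover have "(\<Union>y\<in>set ys. A y) = {(x, i). x \<in> V \<and> i < r \<and> (\<exists>y\<in>set ys. col x y = i)}"
    by (auto simp: A_def)
  ultimately show ?thesis by simp
qed

end

section \<open>The lower bound\<close>

text \<open>Here \<open>j\<close> bounds the depth of the splitting and is about
  \<open>log r\<close> in the application. The condition relating \<open>24\<close>,
  \<open>s\<close>, \<open>j\<close> and \<open>r\<close> makes all error terms small.\<close>

lemma exists_k_connected_piece: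
  fixes r k s n j :: nat and c :: "nat set \<Rightarrow> nat"
  assumes "1 \<le> s" "1 \<le> k" "0 < r" and n: "16 * r\<^sup>2 * (k - 1) + 1 < n" and j: "2 * r < 2 ^ j"
    and r: "24 * (2 ^ s) ^ (2 ^ s + 5) * j \<le> r"
    and c: "edge_colouring r (complete_graph n) c"
  shows "\<exists>S H. S \<subseteq> {..<r} \<and> card S \<le> s \<and> subgraph H (complete_graph n) \<and> k_connected k H \<and>
    2 ^ s * (n / (4 * r)) \<le> card (verts H) \<and> (\<forall>e\<in>edges H. c e \<in> S)"
    (is "\<exists>S H. ?piece S H")
proof (rule ccontr)
  assume none: "\<nexists>S H. ?piece S H"
  define Q :: real where "Q = 2 ^ s"
  define x :: real where "x = n / r"
  define L :: real where "L = Q * x / 4"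
  define V where "V = {..<n}"
  define D :: nat where "D = 2 ^ (s - 1)"
  have L_eq: "L = 2 ^ s * (n / (4 * r))" by (simp add: L_def Q_def x_def)
  have "finite V" "card V = n" by (simp_all add: V_def)
  have "n > 1" "n > 0" "r > 0" using n \<open>0 < r\<close> by auto
  have Q2: "2 \<le> Q" using power_increasing[of 1 s "2::real"] \<open>1 \<le> s\<close> by (simp add: Q_def)
  have QD: "Q = 2 * D"
    using \<open>1 \<le> s\<close> by (simp add: Q_def D_def flip: power_Suc)
  have "0 < x" using \<open>n > 0\<close> \<open>r > 0\<close> by (simp add: x_def)
  have rx: "r * x = n" using \<open>r > 0\<close> by (simp add: x_def)
  have "1 \<le> j" using j \<open>r > 0\<close> by (cases j) auto
  have c_less: "c {u, v} < r" if "u \<in> V" "v \<in> V" "u \<noteq> v" for u v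
    using c that by (auto simp: edge_colouring_def complete_graph_def V_def)
  have n_real: "16 * (real r)\<^sup>2 * real (k - 1) \<le> n"
  proof -
    have "16 * r\<^sup>2 * (k - 1) \<le> n" using n by simp
    then have "real (16 * r\<^sup>2 * (k - 1)) \<le> real n" using of_nat_le_iff by blast
    then show ?thesis by simp
  qed

  \<comment> \<open>For \<open>k = 1\<close> a single edge is already \<open>1\<close>-connected on
    two vertices, so \<open>L \<le> 2\<close> would contradict \<open>none\<close>. For larger
    \<open>k\<close> the hypothesis on \<open>n\<close> gives
    \<open>L \<ge> x / 2 \<ge> 8 * (k - 1)\<close>.\<close>
  have "2 < L \<and> k < L"
  proof (cases "k = 1")
    case True
    have "?piece {c {0, 1}} ({0, 1}, {{0, 1}})" if "L \<le> 2"
    proof -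
      have "k_connected k ({0, 1}, {{0::nat, 1}})"
        unfolding k_connected_def
      proof (intro conjI allI impI)
        fix X assume "X \<subseteq> verts ({0, 1}, {{0::nat, 1}})" "card X < k"
        then have "X = {}" using True finite_subset[of X "{0, 1}"] by simp
        then show "connected_graph (delete_verts ({0, 1}, {{0::nat, 1}}) X)"
          by (auto simp: connected_graph_def delete_verts_def insert_commute)
      qed (use True in simp)
      moreover have "c {0, 1} < r" using c_less[of 0 1] \<open>n > 1\<close> by (simp add: V_def)
      ultimately show ?thesis
        using that \<open>n > 1\<close> \<open>1 \<le> s\<close> unfolding L_eq
        by (auto simp: subgraph_def simple_graph_def complete_graph_def)
    qed
    then have "\<not> L \<le> 2" using none by blast
    then show ?thesis using True by simp
  next
    case False
    then have "k \<ge> 2" using \<open>1 \<le> k\<close> by simp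
    then have "k \<le> 2 * (k - 1)" by simp
    then have "k \<le> 2 * real (k - 1)" by (metis of_nat_le_iff of_nat_mult of_nat_numeral)
    moreover have "16 * real r * real (k - 1) \<le> x"
      using n_real \<open>r > 0\<close> by (simp add: x_def field_simps power2_eq_square)
    moreover have "x \<le> 2 * L" using Q2 \<open>0 < x\<close> by (simp add: L_def)
    moreover have "8 * real (k - 1) \<le> 8 * real r * real (k - 1)"
      using \<open>r > 0\<close> by (simp add: mult_le_cancel_right1)
    ultimately show ?thesis using \<open>k \<ge> 2\<close> by linarith
  qed
  then have "2 < L" "k < L" by auto

  \<comment> \<open>Partitions for every set of at most \<open>s\<close> colours\<close>
  define pieces where "pieces S p \<longleftrightarrow> (\<forall>u\<in>V. card {v \<in> V. p v = (p u :: nat)} < L) \<and>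
      card {(u, v). u \<in> V \<and> v \<in> V \<and> (u \<noteq> v \<and> c {u, v} \<in> S) \<and> p u \<noteq> p v} \<le> 2 * (k - 1) * n * j"
    for S p
  have cut: "\<exists>p. pieces S p"
    if S: "S \<subseteq> {..<r}" "card S \<le> s" for S
  proof -
    \<comment> \<open>\<open>c\<close> is unconstrained on singletons, and a loop would give
      \<open>induced\<close> an edge with one vertex.\<close>
    define adj where "adj u v \<longleftrightarrow> u \<noteq> v \<and> c {u, v} \<in> S" for u v
    have "symp adj" by (auto simp: adj_def symp_def insert_commute)
    have "\<not> k_connected k (induced adj U)" if U: "U \<subseteq> V" "L \<le> card U" for U
    proof
      assume "k_connected k (induced adj U)"
      then have "?piece S (induced adj U)"
        using S U unfolding L_eq
        by (auto simp: subgraph_def simple_graph_def induced_def complete_graph_def adj_def V_def)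
      then show False using none by blast
    qed
    \<comment> \<open>Since \<open>Q \<ge> 2\<close>,
      \<open>n = r * x \<le> 2 * r * L < 2 ^ j * L\<close>.\<close>
    moreover have "card V < 2 ^ j * L"
    proof -
      have "2 * real r < 2 ^ j" using j by (metis of_nat_less_iff of_nat_mult of_nat_numeral of_nat_power)
      then have "2 * real r * L < 2 ^ j * L" using \<open>2 < L\<close> by simp
      moreover have "2 * real r * (2 * x / 4) \<le> 2 * real r * L"
        unfolding L_def using Q2 \<open>0 < x\<close> \<open>r > 0\<close> by (intro mult_left_mono) auto
      ultimately show ?thesis using rx \<open>card V = n\<close> by simp
    qed
    ultimately show ?thesis
      using few_cut_edges[OF \<open>finite V\<close> \<open>symp adj\<close> \<open>k < L\<close>] \<open>1 \<le> k\<close>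
      unfolding adj_def pieces_def \<open>card V = n\<close> by auto
  qed

  \<comment> \<open>A colouring of almost all pairs with small degrees\<close>
  have "\<exists>p. pieces {i} p" if "i < r" for i
    using that \<open>1 \<le> s\<close> by (intro cut) auto
  then obtain q where "\<And>i. i < r \<Longrightarrow> pieces {i} (q i)" by metis
  then have q_class: "\<And>i u. i < r \<Longrightarrow> u \<in> V \<Longrightarrow> card {v \<in> V. q i v = q i u} < L"
    and q_cut: "\<And>i. i < r \<Longrightarrow> card {(u, v). u \<in> V \<and> v \<in> V \<and> (u \<noteq> v \<and> c {u, v} \<in> {i}) \<and>
      q i u \<noteq> q i v} \<le> 2 * (k - 1) * n * j"
    unfolding pieces_def by blast+
  \<comment> \<open>The value \<open>r\<close> marks the diagonal and the edges cut by the partition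
    of their own colour. All remaining neighbours of \<open>u\<close> in colour \<open>i\<close> lie
    in the part of \<open>u\<close>, so there are fewer than \<open>L\<close> of them.\<close>
  define col where
    "col u v = (if u \<noteq> v \<and> q (c {u, v}) u = q (c {u, v}) v then c {u, v} else r)" for u v
  have col_sym: "col u v = col v u" for u v by (auto simp: col_def insert_commute)
  have col_eq: "u \<noteq> v \<and> c {u, v} = i \<and> q i u = q i v" if "col u v = i" "i < r" for u v i
    using that by (auto simp: col_def split: if_splits)
  define \<Delta> where "\<Delta> = Q * x"
  \<comment> \<open>Chosen so that \<open>D * \<delta> = 1 / 8\<close> in the final count.\<close>
  define \<delta> where "\<delta> = 1 / (4 * Q)"
  have "0 \<le> \<Delta>" "L \<le> \<Delta>" using Q2 \<open>0 < x\<close> by (auto simp: \<Delta>_def L_def)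
  have "0 < \<delta>" using Q2 by (simp add: \<delta>_def)
  have deg: "card {v \<in> V. col u v = i} \<le> \<Delta>" if "u \<in> V" "i < r" for u i
  proof -
    have "card {v \<in> V. col u v = i} \<le> card {v \<in> V. q i v = q i u}"
      using that col_eq \<open>finite V\<close> by (intro card_mono) force+
    then show ?thesis using q_class[OF that(2,1)] \<open>L \<le> \<Delta>\<close> by linarith
  qed

  define \<rho> where "\<rho> = real (2 * (k - 1) * n * j)"
  \<comment> \<open>The hypothesis on \<open>n\<close> bounds the cut pairs of any one partition by
    \<open>j * n^2 / (8 * r^2)\<close>.\<close>
  have \<rho>_le: "8 * (real r)\<^sup>2 * \<rho> \<le> (real n)\<^sup>2 * j"
  proof -
    have "16 * (real r)\<^sup>2 * real (k - 1) * (n * j) \<le> n * (real n * j)"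
      using n_real by (intro mult_mono) auto
    then show ?thesis by (simp add: \<rho>_def power2_eq_square mult_ac)
  qed

  define I where "I = {(u, v). u \<in> V \<and> v \<in> V \<and> r \<le> col u v}"
  have finI: "finite I" by (rule finite_subset[of _ "V \<times> V"]) (use \<open>finite V\<close> in \<open>auto simp: I_def\<close>)
  have card_I: "8 * real r * card I \<le> (j + Q) * (real n)\<^sup>2"
  proof -
    define C where "C i = {(u, v). u \<in> V \<and> v \<in> V \<and> (u \<noteq> v \<and> c {u, v} \<in> {i}) \<and> q i u \<noteq> q i v}" for i
    have finC: "finite (C i)" for i
      by (rule finite_subset[of _ "V \<times> V"]) (use \<open>finite V\<close> in \<open>auto simp: C_def\<close>)
    \<comment> \<open>A pair without a colour is diagonal or cut in its own colour. The diagonal is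
      absorbed below by \<open>L > 2\<close>, which gives \<open>8 * r \<le> Q * n\<close>.\<close>
    have "I \<subseteq> (\<lambda>v. (v, v)) ` V \<union> (\<Union>i<r. C i)"
      using c_less by (fastforce simp: I_def col_def C_def split: if_splits)
    then have "card I \<le> card ((\<lambda>v. (v, v)) ` V \<union> (\<Union>i<r. C i))"
      using \<open>finite V\<close> finC by (intro card_mono) auto
    also have "\<dots> \<le> card V + card (\<Union>i<r. C i)"
      by (intro order_trans[OF card_Un_le] add_right_mono card_image_le \<open>finite V\<close>)
    finally have "real (card I) \<le> n + real (card (\<Union>i<r. C i))"
      unfolding \<open>card V = n\<close> by linarith
    also have "card (\<Union>i<r. C i) \<le> card {..<r} * \<rho>"
      unfolding \<rho>_def using q_cut by (intro card_UN_bounded) (auto simp: C_def simp flip: of_nat_mult simp del: of_nat_mult)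
    finally have "card I \<le> n + r * \<rho>" by simp
    then have "8 * real r * card I \<le> 8 * real r * (n + r * \<rho>)" by (intro mult_left_mono) auto
    also have "\<dots> = (8 * real r) * n + 8 * (real r)\<^sup>2 * \<rho>" by (simp add: power2_eq_square algebra_simps)
    also have "\<dots> \<le> (Q * n) * n + (real n)\<^sup>2 * j"
    proof (intro add_mono mult_right_mono \<rho>_le)
      have "8 * real r * 1 \<le> 8 * real r * (L / 2)" using \<open>2 < L\<close> by (intro mult_left_mono) auto
      also have "\<dots> = Q * (r * x)" by (simp add: L_def)
      finally show "8 * real r \<le> Q * n" using rx by simp
    qed auto
    finally show ?thesis by (simp add: power2_eq_square algebra_simps)
  qed

  \<comment> \<open>Typical vertices and near pairs\<close>
  define W where "W = {v \<in> V. card {u \<in> V. r \<le> col u v} \<le> \<delta> * n}"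
  have "W \<subseteq> V" by (auto simp: W_def)
  then have finW: "finite W" using \<open>finite V\<close> by (rule finite_subset)
  have card_VW: "real r * card (V - W) \<le> Q\<^sup>2 * j * n"
  proof -
    \<comment> \<open>Markov's inequality: each vertex outside \<open>W\<close> accounts for more
      than \<open>\<delta> * n\<close> pairs of \<open>I\<close>.\<close>
    have "card (V - W) * (\<delta> * n) \<le> card (SIGMA v:V - W. {u \<in> V. r \<le> col u v})"
      using \<open>finite V\<close> by (intro card_Sigma_ge) (auto simp: W_def)
    also have "card (SIGMA v:V - W. {u \<in> V. r \<le> col u v}) \<le> card I"
      using finI col_sym by (intro card_mono) (auto simp: I_def)
    finally have "card (V - W) * (\<delta> * n) \<le> card I" by simp
    then have "8 * real r * (card (V - W) * (\<delta> * n)) \<le> 8 * real r * card I" by (intro mult_left_mono) auto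
    also note card_I
    finally have "4 * Q * (8 * real r * (card (V - W) * (\<delta> * n))) \<le> 4 * Q * ((j + Q) * (real n)\<^sup>2)"
      using Q2 by (intro mult_left_mono) auto
    then have "(8 * real r * card (V - W)) * n \<le> (4 * Q * (j + Q) * n) * n"
      using Q2 by (simp add: \<delta>_def power2_eq_square mult_ac)
    then have "8 * real r * card (V - W) \<le> 4 * Q * (j + Q) * n" using \<open>n > 0\<close> by simp
    also have "\<dots> \<le> 4 * Q * (2 * (Q * j)) * n"
    proof (intro mult_right_mono mult_left_mono)
      have "0 \<le> (Q - 1) * (real j - 1)" using Q2 \<open>1 \<le> j\<close> by (intro mult_nonneg_nonneg) auto
      moreover have "1 * 1 \<le> Q * j" using Q2 \<open>1 \<le> j\<close> by (intro mult_mono) auto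
      ultimately show "j + Q \<le> 2 * (Q * j)" by (simp add: algebra_simps)
    qed (use Q2 in auto)
    finally show ?thesis by (simp add: power2_eq_square algebra_simps)
  qed

  define agree where "agree y z = {u \<in> V. col u y = col u z \<and> col u y < r}" for y z
  \<comment> \<open>A few vertices which are pairwise not near see a typical vertex in distinct colours.\<close>
  define near where "near y z \<longleftrightarrow> r \<le> col y z \<or> \<delta> * n < card (agree y z)" for y z
  have agree_sym: "agree y z = agree z y" for y z by (auto simp: agree_def)
  have near_refl: "near y y" for y by (simp add: near_def col_def)
  interpret spread_trees W col near r \<Delta>
  proof
    show "card {y \<in> W. col u y = i} \<le> \<Delta>" if "u \<in> W" "i < r" for u i
    proof -
      have "card {y \<in> W. col u y = i} \<le> card {y \<in> V. col u y = i}"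
        using \<open>W \<subseteq> V\<close> \<open>finite V\<close> by (intro card_mono) auto
      then show ?thesis using deg[of u i] that \<open>W \<subseteq> V\<close> by fastforce
    qed
  qed (use finW col_sym agree_sym \<open>0 \<le> \<Delta>\<close> in \<open>auto simp: near_def\<close>)

  define N where "N = real (card {(y, z). y \<in> W \<and> z \<in> W \<and> near y z})"
  have N_le: "r * N \<le> 5 * Q\<^sup>2 * j * (real n)\<^sup>2"
  proof -
    define A where "A = {(y, z). y \<in> V \<and> z \<in> V \<and> \<delta> * n < card (agree y z)}"
    \<comment> \<open>Triples counted in two ways: each pair of \<open>A\<close> agrees at more than
      \<open>\<delta> * n\<close> vertices \<open>u\<close>, while for given \<open>y\<close> and
      \<open>u\<close> at most \<open>\<Delta>\<close> vertices \<open>z\<close> have the same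
      colour to \<open>u\<close>.\<close>
    define B where "B = (SIGMA yu:{(y, u). y \<in> V \<and> u \<in> V \<and> col u y < r}.
      {z \<in> V. col (snd yu) z = col (snd yu) (fst yu)})"
    have finA: "finite A" by (rule finite_subset[of _ "V \<times> V"]) (use \<open>finite V\<close> in \<open>auto simp: A_def\<close>)
    have fin2: "finite {(y, u). y \<in> V \<and> u \<in> V \<and> col u y < r}"
      by (rule finite_subset[of _ "V \<times> V"]) (use \<open>finite V\<close> in auto)
    have finB: "finite B" unfolding B_def using fin2 \<open>finite V\<close> by auto
    have "card A * (\<delta> * n) \<le> card (SIGMA yz:A. agree (fst yz) (snd yz))"
      using finA \<open>finite V\<close> by (intro card_Sigma_ge) (auto simp: A_def agree_def)
    also have "card (SIGMA yz:A. agree (fst yz) (snd yz)) \<le> card ((\<lambda>((y, u), z). ((y, z), u)) ` B)"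
      by (intro card_mono finite_imageI finB) (force simp: A_def B_def agree_def)
    also have "\<dots> \<le> card B" by (rule card_image_le[OF finB])
    also have "card B \<le> card {(y, u). y \<in> V \<and> u \<in> V \<and> col u y < r} * \<Delta>"
      unfolding B_def using fin2 \<open>finite V\<close> deg by (intro card_Sigma_le) auto
    also have "\<dots> \<le> card (V \<times> V) * \<Delta>"
      using \<open>finite V\<close> \<open>0 \<le> \<Delta>\<close> by (intro mult_right_mono of_nat_mono card_mono) auto
    finally have "card A * (\<delta> * n) \<le> (n * \<Delta>) * n"
      by (simp add: card_cartesian_product \<open>card V = n\<close> mult_ac)
    then have "card A * \<delta> \<le> \<Delta> * n" using \<open>n > 0\<close> by (simp flip: mult.assoc)
    then have "card A \<le> 4 * Q * (n * \<Delta>)" using Q2 by (simp add: \<delta>_def field_simps)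
    then have "8 * real r * card A \<le> 8 * real r * (4 * Q * (n * \<Delta>))" by (intro mult_left_mono) auto
    also have "\<dots> = 32 * Q\<^sup>2 * (real n)\<^sup>2"
      using rx by (simp add: \<Delta>_def power2_eq_square mult_ac)
    finally have cardA: "8 * real r * card A \<le> 32 * Q\<^sup>2 * (real n)\<^sup>2" .
    have "{(y, z). y \<in> W \<and> z \<in> W \<and> near y z} \<subseteq> I \<union> A"
      using \<open>W \<subseteq> V\<close> by (auto simp: near_def I_def A_def)
    then have "card {(y, z). y \<in> W \<and> z \<in> W \<and> near y z} \<le> card I + card A"
      using finI finA by (intro order_trans[OF card_mono card_Un_le]) auto
    then have "N \<le> real (card I) + card A" by (simp add: N_def)
    then have "8 * real r * N \<le> 8 * real r * (real (card I) + card A)" by (intro mult_left_mono) auto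
    also have "\<dots> \<le> (j + Q) * (real n)\<^sup>2 + 32 * Q\<^sup>2 * (real n)\<^sup>2"
      using card_I cardA by (simp add: algebra_simps)
    also have "\<dots> = (j + Q + 32 * Q\<^sup>2) * (real n)\<^sup>2" by (simp add: algebra_simps)
    also have "\<dots> \<le> (40 * (Q\<^sup>2 * j)) * (real n)\<^sup>2"
    proof (rule mult_right_mono)
      have "1 \<le> Q\<^sup>2" "Q \<le> Q\<^sup>2" using Q2 one_le_power[of Q 2] by (auto simp: power2_eq_square)
      then have "1 * j \<le> Q\<^sup>2 * j" "Q\<^sup>2 * 1 \<le> Q\<^sup>2 * j" 
        using \<open>1 \<le> j\<close> mult_left_mono[of 1 "real j" "Q\<^sup>2"] mult_right_mono[of 1 "Q\<^sup>2" "real j"]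
        by auto
      then show "j + Q + 32 * Q\<^sup>2 \<le> 40 * (Q\<^sup>2 * j)" using \<open>Q \<le> Q\<^sup>2\<close> by linarith
    qed simp
    finally show ?thesis by (simp add: mult_ac)
  qed

  \<comment> \<open>Many spread trees with the same \<open>s - 1\<close> colours\<close>
  define q where "q = (2 ^ s :: nat)"
  \<comment> \<open>From here \<open>q\<close> is \<open>Q\<close> as a natural number, for use in
    exponents; the single-colour partitions remain present through \<open>col\<close>.\<close>
  have Qq: "Q = q" by (simp add: q_def Q_def)
  have Qpow: "24 * Q ^ (q + 5) * j \<le> r"
  proof -
    have "24 * q ^ (q + 5) * j \<le> r" using r by (simp add: q_def)
    then have "real (24 * q ^ (q + 5) * j) \<le> r" using of_nat_le_iff by blast
    then show ?thesis by (simp add: Qq)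
  qed
  \<comment> \<open>Large enough to cover both the loss \<open>V - W\<close> and the near pairs,
    with \<open>Q ^ (q + 4)\<close> collecting \<open>4 ^ (s - 1)\<close>, the bound on
    \<open>N\<close> and the power of \<open>Q\<close>. Still
    \<open>Q * \<beta> \<le> 1 / 2\<close>, so at least half of the expected trees survive.\<close>
  define \<beta> where "\<beta> = 2 * Q ^ (q + 4) * j / r"
  have "0 \<le> \<beta>" using Q2 by (simp add: \<beta>_def)
  have r\<beta>: "r * \<beta> = 2 * Q ^ (q + 4) * j" using \<open>r > 0\<close> by (simp add: \<beta>_def)
  have Q\<beta>: "Q * \<beta> \<le> 1 / 2"
  proof -
    have "2 * (2 * Q ^ (q + 5) * j) \<le> 24 * Q ^ (q + 5) * j" using Q2 by simp
    also note Qpow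
    finally have "2 * (Q * (r * \<beta>)) \<le> r"
      unfolding r\<beta> by (simp add: power_add numeral_eq_Suc mult_ac)
    then have "r * (2 * (Q * \<beta>)) \<le> real r * 1" by (simp add: mult_ac)
    then have "2 * (Q * \<beta>) \<le> 1" using \<open>r > 0\<close> by (subst (asm) mult_le_cancel_left_pos) auto
    then show ?thesis by simp
  qed
  have s1: "(2::real) ^ (s - 1 + 1) = Q" using \<open>1 \<le> s\<close> by (simp add: Q_def)
  have "\<exists>is. length is = s - 1 \<and> set is \<subseteq> {..<r} \<and>
    r * x ^ 2 ^ (s - 1) * (1 - (2 ^ (s - 1 + 1) - 1) * \<beta>) \<le> card (trees is)"
  proof (rule many_trees[where T = "s - 1" and Q = Q])
    show "r * x * (1 - \<beta>) \<le> card W"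
    proof -
      have "Q\<^sup>2 * j * n \<le> r * \<beta> * n"
      proof -
        have "Q\<^sup>2 \<le> Q ^ (q + 4)" using Q2 by (intro power_increasing) auto
        also have "\<dots> \<le> 2 * Q ^ (q + 4)" using Q2 by simp
        finally show ?thesis unfolding r\<beta> by (intro mult_right_mono) auto
      qed
      then have "real r * card (V - W) \<le> r * (\<beta> * n)" using card_VW by simp
      then have "card (V - W) \<le> \<beta> * n" using \<open>r > 0\<close> by simp
      moreover have "real (card (V - W)) = n - real (card W)"
        using \<open>W \<subseteq> V\<close> finW \<open>finite V\<close> \<open>card V = n\<close>
        by (simp add: card_Diff_subset card_mono of_nat_diff flip: \<open>card V = n\<close>)
      ultimately show ?thesis unfolding rx by (simp add: algebra_simps)
    qed
    show "4 ^ (s - 1) * real (card {(y, z). y \<in> W \<and> z \<in> W \<and> near y z}) * Q ^ 2 ^ (s - 1)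
      \<le> \<beta> * (real r)\<^sup>2 * x\<^sup>2"
    proof -
      have "(4::real) ^ (s - 1) = (2 ^ (s - 1))\<^sup>2" by (simp add: power_mult[symmetric] mult.commute power2_eq_square flip: power_mult_distrib)
      then have four: "(4::real) ^ (s - 1) = Q\<^sup>2 / 4"
        by (simp add: QD D_def power2_eq_square)
      have "2 ^ (s - 1) \<le> q" unfolding q_def by (intro power_increasing) auto
      then have "Q ^ 2 ^ (s - 1) \<le> Q ^ q" using Q2 by (intro power_increasing) auto
      then have "4 ^ (s - 1) * N * Q ^ 2 ^ (s - 1) \<le> Q\<^sup>2 / 4 * N * Q ^ q"
        unfolding four using Q2 by (intro mult_left_mono) (auto simp: N_def)
      then have "r * (4 ^ (s - 1) * N * Q ^ 2 ^ (s - 1)) \<le> r * (Q\<^sup>2 / 4 * N * Q ^ q)"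
        by (intro mult_left_mono) auto
      also have "\<dots> = Q\<^sup>2 / 4 * (r * N) * Q ^ q" by simp
      also have "\<dots> \<le> Q\<^sup>2 / 4 * (5 * Q\<^sup>2 * j * (real n)\<^sup>2) * Q ^ q"
        using N_le Q2 by (intro mult_right_mono mult_left_mono) auto
      also have "\<dots> = 5 / 4 * (Q ^ (q + 4) * j * (real n)\<^sup>2)"
        by (simp add: power_add numeral_eq_Suc mult_ac)
      also have "\<dots> \<le> 2 * (Q ^ (q + 4) * j * (real n)\<^sup>2)"
        using Q2 by (intro mult_right_mono) auto
      also have "\<dots> = r * (\<beta> * (real n)\<^sup>2)"
        using r\<beta> by (simp flip: mult.assoc)
      finally have "4 ^ (s - 1) * N * Q ^ 2 ^ (s - 1) \<le> \<beta> * (real n)\<^sup>2" using \<open>r > 0\<close> by simp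
      then show ?thesis by (simp add: N_def flip: rx power_mult_distrib mult.assoc)
          (simp add: power_mult_distrib mult_ac)
    qed
    show "2 ^ (s - 1 + 1) * \<beta> \<le> 1" using Q\<beta> unfolding s1 by simp
  qed (use \<open>r > 0\<close> \<open>0 < x\<close> Q2 \<open>0 \<le> \<beta>\<close> in \<open>auto simp: \<Delta>_def\<close>)
  then obtain "is" where iss: "length is = s - 1" "set is \<subseteq> {..<r}"
    and "r * x ^ D * (1 - (Q - 1) * \<beta>) \<le> card (trees is)"
    unfolding s1 by (auto simp: D_def)
  moreover have "r * x ^ D * (1 / 2) \<le> r * x ^ D * (1 - (Q - 1) * \<beta>)"
    using Q\<beta> \<open>0 \<le> \<beta>\<close> \<open>0 < x\<close> by (intro mult_left_mono) (auto simp: algebra_simps)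
  ultimately have card_trees: "r * x ^ D / 2 \<le> card (trees is)" by simp

  \<comment> \<open>Pairs of a vertex and a colour seen by a tree\<close>
  have "\<exists>p. pieces (insert i (set is)) p" if "i < r" for i
  proof (rule cut)
    \<comment> \<open>The \<open>s - 1\<close> colours of the trees leave room for one further
      colour \<open>i\<close>.\<close>
    have "card (insert i (set is)) \<le> Suc (length is)"
      using card_insert_le_m1[of "Suc (length is)" "set is" i] card_length[of "is"] by simp
    then show "card (insert i (set is)) \<le> s" using iss \<open>1 \<le> s\<close> by simp
  qed (use iss that in auto)
  then obtain p where "\<And>i. i < r \<Longrightarrow> pieces (insert i (set is)) (p i)" by metis
  then have p_class: "\<And>i u. i < r \<Longrightarrow> u \<in> V \<Longrightarrow> card {v \<in> V. p i v = p i u} < L"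
    and p_cut: "\<And>i. i < r \<Longrightarrow> card {(u, v). u \<in> V \<and> v \<in> V \<and>
      (u \<noteq> v \<and> c {u, v} \<in> insert i (set is)) \<and> p i u \<noteq> p i v} \<le> 2 * (k - 1) * n * j"
    unfolding pieces_def by blast+
  define M where "M = 2 ^ (s - 1) * ((1 - \<delta>) * n) - (2 ^ (s - 1))\<^sup>2 * (\<delta> * n)"
  have twoD: "(2::real) ^ (s - 1) = D" by (simp add: D_def)
  have count: "card (trees is) * M \<le>
    card (trees is) * (r * L) + r * (2 ^ (s - 1) :: real)\<^sup>2 * \<rho> * \<Delta> ^ (2 ^ (s - 1) - 1)"
  proof (rule card_joined_triples_le[OF \<open>finite V\<close> \<open>W \<subseteq> V\<close> iss(2,1)])
    show "card {x \<in> V. col x y = i} \<le> \<Delta>" if "y \<in> W" "i < r" for y i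
      using deg[of y i] that \<open>W \<subseteq> V\<close> by (auto simp: col_sym)
    show "card {v \<in> V. p i v = p i u} \<le> L" if "u \<in> V" "i < r" for u i
      using p_class[OF that(2,1)] by simp
    show "card {(u, v). u \<in> V \<and> v \<in> V \<and> col u v \<in> insert i (set is) \<and> p i u \<noteq> p i v} \<le> \<rho>"
      if "i < r" for i
    proof -
      have "card {(u, v). u \<in> V \<and> v \<in> V \<and> col u v \<in> insert i (set is) \<and> p i u \<noteq> p i v}
        \<le> card {(u, v). u \<in> V \<and> v \<in> V \<and> (u \<noteq> v \<and> c {u, v} \<in> insert i (set is)) \<and> p i u \<noteq> p i v}"
      proof (rule card_mono)
        show "finite {(u, v). u \<in> V \<and> v \<in> V \<and> (u \<noteq> v \<and> c {u, v} \<in> insert i (set is)) \<and> p i u \<noteq> p i v}"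
          by (rule finite_subset[of _ "V \<times> V"]) (use \<open>finite V\<close> in auto)
        have "u \<noteq> v \<and> c {u, v} = col u v" if "col u v \<in> insert i (set is)" for u v
          using that iss(2) \<open>i < r\<close> col_eq[of u v] by auto
        then show "{(u, v). u \<in> V \<and> v \<in> V \<and> col u v \<in> insert i (set is) \<and> p i u \<noteq> p i v} \<subseteq>
          {(u, v). u \<in> V \<and> v \<in> V \<and> (u \<noteq> v \<and> c {u, v} \<in> insert i (set is)) \<and> p i u \<noteq> p i v}"
          by fastforce
      qed
      then show ?thesis using p_cut[OF that] unfolding \<rho>_def by linarith
    qed
    show "M \<le> card {(x, i). x \<in> V \<and> i < r \<and> (\<exists>y\<in>set ys. col x y = i)}" if "ys \<in> trees is" for ys
      unfolding M_def
    proof (rule card_joined_ge[OF \<open>finite V\<close> _ that iss(1) near_refl])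
      show "(1 - \<delta>) * n \<le> card {x \<in> V. col x y < r}" if "y \<in> W" for y
      proof -
        have "V = {x \<in> V. col x y < r} \<union> {x \<in> V. r \<le> col x y}" by auto
        then have "n \<le> card {x \<in> V. col x y < r} + card {x \<in> V. r \<le> col x y}"
          using card_Un_le \<open>card V = n\<close> by metis
        then show ?thesis using that by (simp add: W_def algebra_simps)
      qed
      show "card {x \<in> V. col x y = col x z \<and> col x y < r} \<le> \<delta> * n" if "\<not> near y z" for y z
        using that by (simp add: near_def agree_def)
    qed (use \<open>0 < \<delta>\<close> in auto)
  qed
  \<comment> \<open>The parts account for only \<open>r * L = D * n / 2\<close> pairs per tree. The
    surplus \<open>D * n / 4\<close> must come from cut edges.\<close>
  have "3 / 4 * (D * n) \<le> M"
  proof -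
    have D\<delta>: "D * \<delta> = 1 / 8" using Q2 by (simp add: \<delta>_def QD)
    have "M = (D - D * \<delta> - D * (D * \<delta>)) * n"
      by (simp add: M_def D_def power2_eq_square algebra_simps)
    also have "\<dots> = (D - 1 / 8 - D / 8) * n" unfolding D\<delta> by simp
    finally have "M = (D - 1 / 8 - D / 8) * n" .
    moreover have "1 \<le> real D" using Q2 QD by simp
    then have "(3 / 4 * D) * n \<le> (D - 1 / 8 - D / 8) * n" by (intro mult_right_mono) auto
    ultimately show ?thesis by simp
  qed
  then have "card (trees is) * (3 / 4 * (D * n)) \<le> card (trees is) * M" by (intro mult_left_mono) auto
  moreover have "card (trees is) * (r * L) = card (trees is) * (D * n / 2)"
    using rx by (simp add: L_def QD mult_ac)
  moreover have "card (trees is) * (3 / 4 * (D * n)) - card (trees is) * (D * n / 2)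
      = card (trees is) * (D * n / 4)"
    by (simp add: algebra_simps)
  ultimately have "card (trees is) * (D * n / 4) \<le> r * (real D)\<^sup>2 * \<rho> * \<Delta> ^ (D - 1)"
    using count unfolding twoD D_def[symmetric] by linarith
  moreover have "r * x ^ D / 2 * (D * n / 4) \<le> card (trees is) * (D * n / 4)"
    using card_trees by (intro mult_right_mono) auto
  ultimately have "r * x ^ D / 2 * (D * n / 4) \<le> r * (real D)\<^sup>2 * \<rho> * \<Delta> ^ (D - 1)" by linarith
  moreover have "x ^ D = x * x ^ (D - 1)" by (subst power_Suc[symmetric]) (simp add: D_def)
  ultimately have "(r * D * x ^ (D - 1)) * (x * n) \<le> (r * D * x ^ (D - 1)) * (8 * D * Q ^ (D - 1) * \<rho>)"
    by (simp add: \<Delta>_def power_mult_distrib power2_eq_square mult_ac)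
  moreover have "0 < r * D * x ^ (D - 1)" using \<open>r > 0\<close> \<open>0 < x\<close> by (simp add: D_def)
  ultimately have "x * n \<le> 8 * D * Q ^ (D - 1) * \<rho>" by (simp only: mult_le_cancel_left_pos)
  \<comment> \<open>Inserting the bound on \<open>\<rho>\<close> leaves
    \<open>r \<le> D * Q ^ (D - 1) * j\<close>, against the assumed size of
    \<open>r\<close>.\<close>
  then have "(real r)\<^sup>2 * (x * n) \<le> (real r)\<^sup>2 * (8 * D * Q ^ (D - 1) * \<rho>)" by (intro mult_left_mono) auto
  also have "(real r)\<^sup>2 * (x * n) = r * (real n)\<^sup>2"
    using rx by (simp add: power2_eq_square mult_ac)
  also have "(real r)\<^sup>2 * (8 * D * Q ^ (D - 1) * \<rho>) = D * Q ^ (D - 1) * (8 * (real r)\<^sup>2 * \<rho>)" by simp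
  also have "\<dots> \<le> D * Q ^ (D - 1) * ((real n)\<^sup>2 * j)"
    using \<rho>_le Q2 by (intro mult_left_mono) auto
  finally have "r * (real n)\<^sup>2 \<le> (D * Q ^ (D - 1) * j) * (real n)\<^sup>2" by (simp add: mult_ac)
  then have "r \<le> D * Q ^ (D - 1) * j" using \<open>n > 0\<close> by simp
  also have "\<dots> \<le> Q * Q ^ (D - 1) * j" using QD Q2 by (intro mult_right_mono) auto
  also have "\<dots> \<le> Q ^ (q + 5) * j"
  proof -
    have "D \<le> q" unfolding D_def q_def by (intro power_increasing) auto
    then have "Q ^ Suc (D - 1) \<le> Q ^ (q + 5)" using Q2 by (intro power_increasing) auto
    then show ?thesis by (intro mult_right_mono) auto
  qed
  also have "\<dots> < 24 * Q ^ (q + 5) * j" using Q2 \<open>1 \<le> j\<close> by simp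
  finally show False using Qpow by simp
qed

text \<open>The maximum in \<open>f\<close> is attained because admissible values are at most
  \<open>n\<close>: the constant colouring, which exists as \<open>r > 0\<close>, already forces
  this.\<close>

lemma f_ge:
  assumes "0 < r"
    and m: "\<And>c. edge_colouring r (complete_graph n) c \<Longrightarrow>
      \<exists>S H. S \<subseteq> {..<r} \<and> card S \<le> s \<and> subgraph H (complete_graph n) \<and> k_connected k H \<and>
        m \<le> card (verts H) \<and> (\<forall>e\<in>edges H. c e \<in> S)"
  shows "m \<le> f n r s k"
  unfolding f_def
proof (rule Greatest_le_nat[where b = n])
  fix m'
  assume "\<forall>c. edge_colouring r (complete_graph n) c \<longrightarrow>
     (\<exists>S H. S \<subseteq> {..<r} \<and> card S \<le> s \<and> subgraph H (complete_graph n) \<and> k_connected k H \<and>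
        m' \<le> card (verts H) \<and> (\<forall>e\<in>edges H. c e \<in> S))"
  moreover have "edge_colouring r (complete_graph n) (\<lambda>_. 0)"
    using \<open>0 < r\<close> by (simp add: edge_colouring_def)
  ultimately obtain H where "subgraph H (complete_graph n)" "m' \<le> card (verts H)" by blast
  moreover from this have "card (verts H) \<le> card {..<n}"
    by (intro card_mono) (auto simp: subgraph_def complete_graph_def)
  ultimately show "m' \<le> n" by simp
qed (use m in blast)

text \<open>With \<open>x = log 2 (log 2 r)\<close> the hypothesis reads
  \<open>s \<le> x - sqrt x\<close>. The binary logarithm of the left side is then about
  \<open>x * 2 powr (x - sqrt x)\<close>, which is of smaller order than
  \<open>2 powr x = log 2 r\<close>.\<close>

lemma colour_bound_eventually:
  "\<forall>\<^sub>F r :: nat in sequentially. \<forall>s. real s \<le>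
      (1 - 1 / sqrt (log 2 (log 2 r))) * log 2 (log 2 r) \<longrightarrow>
    (\<exists>j. 2 * r < 2 ^ j \<and> 24 * (2 ^ s) ^ (2 ^ s + 5) * j \<le> r)"
proof -
  have "\<forall>\<^sub>F x :: real in at_top. 24 * 2 powr (x * (2 powr (x - sqrt x) + 5)) * (2 powr x + 3) \<le>
      2 powr (2 powr x)"
    by real_asymp
  then have asymp: "\<forall>\<^sub>F x :: real in at_top. 0 < x \<and>
      24 * 2 powr (x * (2 powr (x - sqrt x) + 5)) * (2 powr x + 3) \<le> 2 powr (2 powr x)"
    using eventually_gt_at_top[of 0] by eventually_elim simp
  have "filterlim (\<lambda>r::nat. log 2 (log 2 (real r))) at_top sequentially"
    by real_asymp
  from eventually_compose_filterlim[OF asymp this] eventually_gt_at_top[of 1]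
  show ?thesis
  proof eventually_elim
    case (elim r)
    define x where "x = log 2 (log 2 (real r))"
    have x: "0 < x" "24 * 2 powr (x * (2 powr (x - sqrt x) + 5)) * (2 powr x + 3) \<le> 2 powr (2 powr x)"
      using elim by (auto simp: x_def)
    have "0 < log 2 (real r)" using elim by simp
    then have powx: "2 powr x = log 2 (real r)" by (simp add: x_def)
    then have powpow: "2 powr (2 powr x) = real r" using elim by simp
    show ?case
    proof (intro allI impI)
      fix s assume "real s \<le> (1 - 1 / sqrt (log 2 (log 2 r))) * log 2 (log 2 r)"
      also have "\<dots> = x - sqrt x"
        using \<open>0 < x\<close> by (simp add: x_def[symmetric] left_diff_distrib real_div_sqrt)
      finally have s: "real s \<le> x - sqrt x" .
      then have "real s \<le> x" using x by (smt (verit) real_sqrt_ge_zero)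
      \<comment> \<open>At least \<open>log 2 r + 2\<close>, so that
        \<open>2 ^ j \<ge> 4 * r\<close>.\<close>
      define j where "j = nat \<lceil>2 powr x\<rceil> + 2"
      have j: "2 powr x + 2 \<le> j" "j \<le> 2 powr x + 3"
        using ceiling_correct[of "2 powr x"] by (simp_all add: j_def)
      have "2 * real r < 4 * real r" using elim by simp
      also have "\<dots> = 2 powr (2 powr x + 2)" using powpow by (simp add: powr_add)
      also have "\<dots> \<le> 2 powr j" using j by (intro powr_mono) auto
      finally have "real (2 * r) < real (2 ^ j)" by (simp add: powr_realpow)
      then have "2 * r < 2 ^ j" by (simp only: of_nat_less_iff)
      have pow_s: "(2::real) ^ s \<le> 2 powr (x - sqrt x)"
        using s by (subst powr_realpow[symmetric]) (auto intro: powr_mono)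
      have "real (24 * (2 ^ s) ^ (2 ^ s + 5) * j) = 24 * 2 powr (s * (2 ^ s + 5)) * j"
        by (simp add: powr_realpow[symmetric] powr_powr)
      also have "\<dots> \<le> 24 * 2 powr (x * (2 powr (x - sqrt x) + 5)) * (2 powr x + 3)"
      proof (intro mult_mono powr_mono)
        show "s * (2 ^ s + 5) \<le> x * (2 powr (x - sqrt x) + 5)"
          unfolding of_nat_mult using pow_s \<open>real s \<le> x\<close> x by (intro mult_mono) auto
      qed (use j in auto)
      also have "\<dots> \<le> real r" using x powpow by simp
      finally have "24 * (2 ^ s) ^ (2 ^ s + 5) * j \<le> r" by (simp only: of_nat_le_iff)
      with \<open>2 * r < 2 ^ j\<close> show "\<exists>j. 2 * r < 2 ^ j \<and> 24 * (2 ^ s) ^ (2 ^ s + 5) * j \<le> r" by blast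
    qed
  qed
qed

theorem theorem3p5:
  "\<exists>\<epsilon> :: nat \<Rightarrow> real. \<epsilon> \<longlonglongrightarrow> 0 \<and>
     (\<forall>r k s n :: nat. 2 \<le> r \<longrightarrow> 1 \<le> k \<longrightarrow> 1 \<le> s \<longrightarrow>
        real s \<le> (1 - \<epsilon> r) * log 2 (log 2 (real r)) \<longrightarrow>
        n > 16 * r ^ 2 * (k - 1) + 1 \<longrightarrow>
        real (f n r s k) \<ge> 2 powi (int s - 2) * (real n / real r))"
proof -
  define \<eta> where "\<eta> r = 1 / sqrt (log 2 (log 2 (real r)))" for r
  define good where "good r \<longleftrightarrow> (\<forall>s. real s \<le> (1 - \<eta> r) * log 2 (log 2 r) \<longrightarrow>
    (\<exists>j. 2 * r < 2 ^ j \<and> 24 * (2 ^ s) ^ (2 ^ s + 5) * j \<le> r))" for r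
  \<comment> \<open>At the finitely many \<open>r\<close> that are not good, the value
    \<open>1\<close> turns the bound into \<open>s \<le> 0\<close>, which excludes every
    \<open>s \<ge> 1\<close>.\<close>
  define \<epsilon> where "\<epsilon> r = (if good r then \<eta> r else 1)" for r
  have "\<forall>\<^sub>F r in sequentially. \<eta> r = \<epsilon> r"
    using colour_bound_eventually by eventually_elim (simp add: \<epsilon>_def good_def \<eta>_def)
  moreover have "\<eta> \<longlonglongrightarrow> 0" unfolding \<eta>_def by real_asymp
  ultimately have "\<epsilon> \<longlonglongrightarrow> 0" by (rule Lim_transform_eventually[rotated])
  moreover have "2 powi (int s - 2) * (real n / real r) \<le> real (f n r s k)"
    if "2 \<le> r" "1 \<le> k" "1 \<le> s" and s: "real s \<le> (1 - \<epsilon> r) * log 2 (log 2 (real r))"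
      and n: "n > 16 * r ^ 2 * (k - 1) + 1" for r k s n :: nat
  proof -
    have "good r" using s \<open>1 \<le> s\<close> by (cases "good r") (auto simp: \<epsilon>_def)
    with s have "real s \<le> (1 - \<eta> r) * log 2 (log 2 (real r))" by (simp add: \<epsilon>_def)
    with \<open>good r\<close> obtain j where j: "2 * r < 2 ^ j" "24 * (2 ^ s) ^ (2 ^ s + 5) * j \<le> r"
      unfolding good_def by blast
    define m where "m = nat \<lceil>2 ^ s * (n / (4 * r))\<rceil>"
    have "m \<le> f n r s k"
    proof (rule f_ge)
      fix c assume "edge_colouring r (complete_graph n) c"
      from exists_k_connected_piece[OF \<open>1 \<le> s\<close> \<open>1 \<le> k\<close> _ n j this] \<open>2 \<le> r\<close>
      obtain S H where SH: "S \<subseteq> {..<r}" "card S \<le> s" "subgraph H (complete_graph n)" "k_connected k H"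
        "2 ^ s * (n / (4 * r)) \<le> card (verts H)" "\<forall>e\<in>edges H. c e \<in> S" by auto
      have "m \<le> card (verts H)" using SH(5) by (simp add: m_def ceiling_le_iff)
      with SH show "\<exists>S H. S \<subseteq> {..<r} \<and> card S \<le> s \<and> subgraph H (complete_graph n) \<and>
          k_connected k H \<and> m \<le> card (verts H) \<and> (\<forall>e\<in>edges H. c e \<in> S)" by blast
    qed (use \<open>2 \<le> r\<close> in simp)
    moreover have "2 powi (int s - 2) * (real n / real r) = 2 ^ s * (n / (4 * r))"
      by (simp add: power_int_diff)
    moreover have "2 ^ s * (n / (4 * r)) \<le> m" unfolding m_def by (rule of_nat_ceiling)
    ultimately show ?thesis by linarith
  qed
  ultimately show ?thesis by blast
qed

end
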